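(* Let $I$ be a non-degenerate interval and $f:I\to\mathbb{R}$ continuous. Then (i) every point at which $f$ has a derivative (finite or infinite) is an $\mathsf{M}$-point of $f$; (ii) there is a set $E\subseteq I$ with $\mathcal{H}^1(\{(x,f(x)):x\in E\})=0$ such that every $\mathsf{M}$-point of $f$ belongs to $D_{ap}(f)\cup K_{ap}(f)\cup E$. In particular, for $\mathcal{H}^1$-almost every point $(x,f(x))$ of the graph with $x$ an $\mathsf{M}$-point not in $D_{ap}(f)$, $x$ is a knot point of $f$.
   Context: $\mathcal{H}^1$ is one-dimensional Hausdorff measure in $\mathbb{R}^2$. Let $\psi(x)=(x,f(x))$, $|\cdot|$ the Euclidean norm. For $c\ge1$, $y\in I$ is an $\mathsf{M}_c$-point of $f$ if there is $\varepsilon>0$ with $|\psi(x)-\psi(y)|\le c|\psi(x)-\psi(z)|$ for all $x\in I\cap(y-\varepsilon,y)$, $z\in I\cap(y,y+\varepsilon)$; an $\mathsf{M}$-point is an $\mathsf{M}_c$-point for some $c\ge1$. The approximate upper right Dini derivative is $\overline{f}^+_{ap}(x)=\inf\{t:\lim_{\delta\to0+}\delta^{-1}\lambda(\{y\in(x,x+\delta):\frac{f(y)-f(x)}{y-x}\le t\})=1\}$ ($\lambda$ Lebesgue measure); the other three approximate Dini derivatives are defined analogously. $D_{ap}(f)$ is the set of points where all four approximate Dini derivatives coincide (the approximate derivative exists); $K_{ap}(f)$ is the set of approximate knot points, where both upper approximate Dini derivatives are $+\infty$ and both lower ones are $-\infty$. A knot point is a point where both upper Dini derivatives are $+\infty$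 and both lower Dini derivatives are $-\infty$. *)

theory Defs
  imports "HOL-Analysis.Analysis"
begin

text \<open>Graph map psi(x) = (x, f x) in R^2 (real \<times> real carries the Euclidean distance).\<close>
definition graph_pt :: "(real \<Rightarrow> real) \<Rightarrow> real \<Rightarrow> real \<times> real" where
  "graph_pt f x = (x, f x)"

definition hausdorff1_delta :: "real \<Rightarrow> (real \<times> real) set \<Rightarrow> ennreal" where
  "hausdorff1_delta \<delta> A =
     (INF C \<in> {C :: nat \<Rightarrow> (real \<times> real) set.
                 A \<subseteq> (\<Union>i. C i) \<and> (\<forall>i. bounded (C i) \<and> diameter (C i) \<le> \<delta>)}.
        (\<Sum>i. ennreal (diameter (C i))))"

definition hausdorff1 :: "(real \<times> real) set \<Rightarrow> ennreal" where
  "hausdorff1 A = (SUP \<delta> \<in> {0<..}. hausdorff1_delta \<delta> A)"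

definition M_c_point :: "(real \<Rightarrow> real) \<Rightarrow> real set \<Rightarrow> real \<Rightarrow> real \<Rightarrow> bool" where
  "M_c_point f I c y \<longleftrightarrow> y \<in> I \<and>
     (\<exists>\<epsilon>>0. \<forall>x \<in> I \<inter> {y-\<epsilon><..<y}. \<forall>z \<in> I \<inter> {y<..<y+\<epsilon>}.
        dist (graph_pt f x) (graph_pt f y) \<le> c * dist (graph_pt f x) (graph_pt f z))"

definition M_point :: "(real \<Rightarrow> real) \<Rightarrow> real set \<Rightarrow> real \<Rightarrow> bool" where
  "M_point f I y \<longleftrightarrow> (\<exists>c\<ge>1. M_c_point f I c y)"

definition has_fin_or_inf_deriv :: "(real \<Rightarrow> real) \<Rightarrow> real set \<Rightarrow> real \<Rightarrow> bool" where
  "has_fin_or_inf_deriv f I y \<longleftrightarrow>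
     (\<exists>D. ((\<lambda>t. (f t - f y) / (t - y)) \<longlongrightarrow> D) (at y within I)) \<or>
     filterlim (\<lambda>t. (f t - f y) / (t - y)) at_top (at y within I) \<or>
     filterlim (\<lambda>t. (f t - f y) / (t - y)) at_bot (at y within I)"

definition ap_upper_right :: "(real \<Rightarrow> real) \<Rightarrow> real set \<Rightarrow> real \<Rightarrow> ereal" where
  "ap_upper_right f I x = Inf {ereal t | t.
     ((\<lambda>\<delta>. measure lborel {y \<in> I \<inter> {x<..<x+\<delta>}. (f y - f x) / (y - x) \<le> t} / \<delta>)
        \<longlongrightarrow> 1) (at_right 0)}"

definition ap_lower_right :: "(real \<Rightarrow> real) \<Rightarrow> real set \<Rightarrow> real \<Rightarrow> ereal" where
  "ap_lower_right f I x = Sup {ereal t | t.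
     ((\<lambda>\<delta>. measure lborel {y \<in> I \<inter> {x<..<x+\<delta>}. (f y - f x) / (y - x) \<ge> t} / \<delta>)
        \<longlongrightarrow> 1) (at_right 0)}"

definition ap_upper_left :: "(real \<Rightarrow> real) \<Rightarrow> real set \<Rightarrow> real \<Rightarrow> ereal" where
  "ap_upper_left f I x = Inf {ereal t | t.
     ((\<lambda>\<delta>. measure lborel {y \<in> I \<inter> {x-\<delta><..<x}. (f y - f x) / (y - x) \<le> t} / \<delta>)
        \<longlongrightarrow> 1) (at_right 0)}"

definition ap_lower_left :: "(real \<Rightarrow> real) \<Rightarrow> real set \<Rightarrow> real \<Rightarrow> ereal" where
  "ap_lower_left f I x = Sup {ereal t | t.
     ((\<lambda>\<delta>. measure lborel {y \<in> I \<inter> {x-\<delta><..<x}. (f y - f x) / (y - x) \<ge> t} / \<delta>)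
        \<longlongrightarrow> 1) (at_right 0)}"

definition D_ap :: "(real \<Rightarrow> real) \<Rightarrow> real set \<Rightarrow> real set" where
  "D_ap f I = {x \<in> I. ap_upper_right f I x = ap_lower_right f I x \<and>
                      ap_lower_right f I x = ap_upper_left f I x \<and>
                      ap_upper_left f I x = ap_lower_left f I x}"

definition K_ap :: "(real \<Rightarrow> real) \<Rightarrow> real set \<Rightarrow> real set" where
  "K_ap f I = {x \<in> I. ap_upper_right f I x = \<infinity> \<and> ap_upper_left f I x = \<infinity> \<and>
                      ap_lower_right f I x = -\<infinity> \<and> ap_lower_left f I x = -\<infinity>}"

definition dini_upper_right :: "(real \<Rightarrow> real) \<Rightarrow> real set \<Rightarrow> real \<Rightarrow> ereal" where
  "dini_upper_right f I x = Limsup (at x within (I \<inter> {x<..})) (\<lambda>t. ereal ((f t - f x) / (t - x)))"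
definition dini_lower_right :: "(real \<Rightarrow> real) \<Rightarrow> real set \<Rightarrow> real \<Rightarrow> ereal" where
  "dini_lower_right f I x = Liminf (at x within (I \<inter> {x<..})) (\<lambda>t. ereal ((f t - f x) / (t - x)))"
definition dini_upper_left :: "(real \<Rightarrow> real) \<Rightarrow> real set \<Rightarrow> real \<Rightarrow> ereal" where
  "dini_upper_left f I x = Limsup (at x within (I \<inter> {..<x})) (\<lambda>t. ereal ((f t - f x) / (t - x)))"
definition dini_lower_left :: "(real \<Rightarrow> real) \<Rightarrow> real set \<Rightarrow> real \<Rightarrow> ereal" where
  "dini_lower_left f I x = Liminf (at x within (I \<inter> {..<x})) (\<lambda>t. ereal ((f t - f x) / (t - x)))"

definition knot_point :: "(real \<Rightarrow> real) \<Rightarrow> real set \<Rightarrow> real \<Rightarrow> bool" where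
  "knot_point f I x \<longleftrightarrow> x \<in> I \<and> dini_upper_right f I x = \<infinity> \<and> dini_upper_left f I x = \<infinity> \<and>
                         dini_lower_right f I x = -\<infinity> \<and> dini_lower_left f I x = -\<infinity>"

end

theory Submission
  imports Defs
begin

text \<open>
  Near an M-point outside \<open>K_ap\<close> one of the four approximate Dini derivates is bounded on the relevant side. Together with
  the M-condition and the intermediate value theorem this yields countably many compact sets \<open>K\<close> carrying these points
  such that, up to a sign, \<open>f - C id\<close> is nonincreasing on \<open>K\<close>. Then \<open>\<phi> x = (C + 1) x - f x\<close> expands distances on \<open>K\<close>, so the graph over
  \<open>K\<close> is a Lipschitz image of \<open>\<phi> ` K\<close> and Lebesgue-null subsets of \<open>\<phi> ` K\<close> may be ignored. At almost every \<open>u = \<phi> x\<close>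
  the set \<open>\<phi> ` K\<close> has density 1 and \<open>\<phi>\<inverse>\<close> is differentiable there. If its derivative is positive, \<open>K\<close> has density 1 at \<open>x\<close> and
  \<open>f\<close> is differentiable relative to \<open>K\<close>, so the approximate derivative exists. If it vanishes, the graph is
  vertical along \<open>K\<close>, and the M-condition at the points of \<open>K\<close> forbids \<open>f\<close> to leave this vertical direction on the gaps
  of \<open>K\<close>; hence the derivative is infinite.
\<close>

section \<open>Null sets of one-dimensional Hausdorff measure\<close>

text \<open>The exceptional set must be null on the graph, and a Lebesgue-null set of abscissae can
  carry graph of positive length where \<open>f\<close> is steep. Almost everywhere statements in
  \<open>x\<close> are therefore too weak, and differentiation takes place in the parameter
  \<open>u = \<phi> x\<close>. The price is the case of derivative 0: there the density of the
  parameter set gives no density of \<open>K\<close> at \<open>x\<close>, so the slope must be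
  controlled on the gaps of \<open>K\<close> as well, which is the second use of the M-condition.
  Since the inverse of \<open>\<phi>\<close> is monotone and 1-Lipschitz, its derivative
  \<open>\<xi>\<close> lies between 0 and 1. The approximate derivative is
  \<open>C + 1 - 1 / \<xi>\<close>, degenerating to \<open>-\<infinity>\<close> at
  \<open>\<xi> = 0\<close>; only a one-sided bound on the slopes along \<open>K\<close> is ever
  available. The pieces can be taken compact because the slope bound, and the M-condition with fixed
  constant and radius, survive limits of points.\<close>

lemma hausdorff1_eq_0I:
  assumes "\<And>e. e > 0 \<Longrightarrow> \<exists>C. A \<subseteq> (\<Union>i::nat. C i) \<and> (\<forall>i. bounded (C i)) \<and>
             (\<Sum>i. ennreal (diameter (C i))) \<le> ennreal e"
  shows "hausdorff1 A = 0"
proof -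
  have "hausdorff1_delta \<delta> A \<le> ennreal e" if "\<delta> > 0" "e > 0" for \<delta> e
  proof -
    \<comment> \<open>Each single diameter is at most the whole sum, so a total of at most
      \<open>\<delta>\<close> already enforces the mesh condition.\<close>
    obtain C where C: "A \<subseteq> (\<Union>i::nat. C i)" "\<And>i. bounded (C i)"
      and sum: "(\<Sum>i. ennreal (diameter (C i))) \<le> ennreal (min \<delta> e)"
      using assms[of "min \<delta> e"] \<open>\<delta> > 0\<close> \<open>e > 0\<close> by auto
    have "diameter (C i) \<le> \<delta>" for i
    proof -
      have "ennreal (diameter (C i)) = (\<Sum>j\<in>{i}. ennreal (diameter (C j)))"
        by simp
      also have "\<dots> \<le> (\<Sum>j. ennreal (diameter (C j)))"
        by (intro sum_le_suminf) auto
      also note sum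
      finally show ?thesis
        using \<open>\<delta> > 0\<close> \<open>e > 0\<close> by (simp add: ennreal_le_iff)
    qed
    then have "hausdorff1_delta \<delta> A \<le> (\<Sum>i. ennreal (diameter (C i)))"
      unfolding hausdorff1_delta_def using C by (intro INF_lower) auto
    also note sum
    also have "ennreal (min \<delta> e) \<le> ennreal e"
      by (simp add: ennreal_leI)
    finally show ?thesis .
  qed
  then have "hausdorff1_delta \<delta> A = 0" if "\<delta> > 0" for \<delta>
    using that by (metis ennreal_le_epsilon add_0 le_zero_eq)
  then show ?thesis
    by (simp add: hausdorff1_def)
qed

lemma hausdorff1_eq_0D:
  assumes "hausdorff1 A = 0" "e > 0"
  obtains C where "A \<subseteq> (\<Union>i::nat. C i)" "\<And>i. bounded (C i)"
    "(\<Sum>i. ennreal (diameter (C i))) \<le> ennreal e"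
proof -
  have "hausdorff1_delta 1 A \<le> hausdorff1 A"
    unfolding hausdorff1_def by (intro SUP_upper) auto
  then have "hausdorff1_delta 1 A < ennreal e"
    using assms by simp
  then show thesis
    unfolding hausdorff1_delta_def INF_less_iff using that by (auto intro: less_imp_le)
qed

lemma hausdorff1_null_subset:
  assumes "hausdorff1 B = 0" "A \<subseteq> B"
  shows "hausdorff1 A = 0"
proof (rule hausdorff1_eq_0I)
  fix e :: real assume "e > 0"
  then obtain C where "B \<subseteq> (\<Union>i::nat. C i)" "\<And>i. bounded (C i)"
    "(\<Sum>i. ennreal (diameter (C i))) \<le> ennreal e"
    using hausdorff1_eq_0D assms(1) by metis
  then show "\<exists>C. A \<subseteq> (\<Union>i::nat. C i) \<and> (\<forall>i. bounded (C i)) \<and>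
             (\<Sum>i. ennreal (diameter (C i))) \<le> ennreal e"
    using assms(2) by blast
qed

lemma hausdorff1_null_UN_nat:
  assumes "\<And>n::nat. hausdorff1 (A n) = 0"
  shows "hausdorff1 (\<Union>n. A n) = 0"
proof (rule hausdorff1_eq_0I)
  fix e :: real assume "e > 0"
  have "\<exists>C. A n \<subseteq> (\<Union>i::nat. C i) \<and> (\<forall>i. bounded (C i)) \<and>
      (\<Sum>i. ennreal (diameter (C i))) \<le> ennreal (e * (1/2) ^ Suc n)" for n
    using hausdorff1_eq_0D[OF assms, of "e * (1/2) ^ Suc n"] \<open>e > 0\<close> by simp metis
  then obtain C where C: "\<And>n. A n \<subseteq> (\<Union>i::nat. C n i)" "\<And>n i. bounded (C n i)"
    "\<And>n. (\<Sum>i. ennreal (diameter (C n i))) \<le> ennreal (e * (1/2) ^ Suc n)"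
    by metis
  let ?D = "\<lambda>k. case prod_decode k of (n, i) \<Rightarrow> C n i"
  have "(\<Union>n. A n) \<subseteq> (\<Union>k. ?D k)"
  proof
    fix x assume "x \<in> (\<Union>n. A n)"
    then obtain n i where "x \<in> C n i"
      using C(1) by blast
    then have "x \<in> ?D (prod_encode (n, i))"
      by simp
    then show "x \<in> (\<Union>k. ?D k)"
      by (rule UN_I[OF UNIV_I])
  qed
  moreover have "\<forall>k. bounded (?D k)"
    using C(2) by (auto split: prod.split)
  moreover have "(\<Sum>k. ennreal (diameter (?D k))) \<le> ennreal e"
  proof -
    have "(\<Sum>k. ennreal (diameter (?D k))) = (\<Sum>k. case_prod (\<lambda>n i. ennreal (diameter (C n i))) (prod_decode k))"
      by (simp add: case_prod_beta)
    also have "\<dots> = (\<Sum>n. \<Sum>i. ennreal (diameter (C n i)))"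
      using suminf_ennreal_2dimen[of "\<lambda>n. \<Sum>i. ennreal (diameter (C n i))"
          "\<lambda>(n, i). ennreal (diameter (C n i))"] by (simp add: comp_def)
    also have "\<dots> \<le> (\<Sum>n. ennreal (e * (1/2) ^ Suc n))"
      by (intro suminf_le C) auto
    also have "\<dots> = ennreal (\<Sum>n. e * (1/2) ^ Suc n)"
      using \<open>e > 0\<close> by (intro suminf_ennreal2) (auto intro!: summable_mult)
    also have "(\<Sum>n. e * (1/2) ^ Suc n) = e"
      using sums_mult[OF power_half_series, of e] by (simp add: sums_iff)
    finally show ?thesis .
  qed
  ultimately show "\<exists>C. (\<Union>n. A n) \<subseteq> (\<Union>i::nat. C i) \<and> (\<forall>i. bounded (C i)) \<and>
             (\<Sum>i. ennreal (diameter (C i))) \<le> ennreal e"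
    by blast
qed

lemma hausdorff1_sing: "hausdorff1 {p} = 0"
proof (rule hausdorff1_eq_0I)
  fix e :: real assume "e > 0"
  then show "\<exists>C. {p} \<subseteq> (\<Union>i::nat. C i) \<and> (\<forall>i. bounded (C i)) \<and>
             (\<Sum>i. ennreal (diameter (C i))) \<le> ennreal e"
    by (intro exI[of _ "\<lambda>_. {p}"]) auto
qed

lemma hausdorff1_null_UN:
  assumes "countable T" "\<And>t. t \<in> T \<Longrightarrow> hausdorff1 (A t) = 0"
  shows "hausdorff1 (\<Union>t\<in>T. A t) = 0"
proof (cases "T = {}")
  case True
  then show ?thesis
    using hausdorff1_null_subset[OF hausdorff1_sing, of "{}"] by simp
next
  case False
  have "(\<Union>t\<in>T. A t) = \<Union> (A ` range (from_nat_into T))"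
    using range_from_nat_into[OF False assms(1)] by simp
  then have "(\<Union>t\<in>T. A t) = (\<Union>n. A (from_nat_into T n))"
    by (simp add: image_image)
  then show ?thesis
    using hausdorff1_null_UN_nat[of "\<lambda>n. A (from_nat_into T n)"] assms(2)
      from_nat_into[OF False] by simp
qed

lemma hausdorff1_null_Un:
  assumes "hausdorff1 A = 0" "hausdorff1 B = 0"
  shows "hausdorff1 (A \<union> B) = 0"
  using hausdorff1_null_UN[of "UNIV" "\<lambda>b. if b then A else B"] assms by (simp add: UNIV_bool Un_commute split: if_splits)

text \<open>Meant for the reflection \<open>(x, y) \<mapsto> (x, - y)\<close>, which carries null
  sets on the graph of \<open>- f\<close> back to the graph of \<open>f\<close>.\<close>

lemma hausdorff1_null_nonexpansive_image:
  assumes "hausdorff1 A = 0" and h: "\<And>p q. dist (h p) (h q) \<le> dist p q"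
  shows "hausdorff1 (h ` A) = 0"
proof (rule hausdorff1_eq_0I)
  fix e :: real assume "e > 0"
  obtain C where C: "A \<subseteq> (\<Union>i::nat. C i)" "\<And>i. bounded (C i)" "(\<Sum>i. ennreal (diameter (C i))) \<le> ennreal e"
    using hausdorff1_eq_0D[OF assms(1) \<open>e > 0\<close>] by metis
  have d: "dist (h p) (h q) \<le> diameter (C i)" if "p \<in> C i" "q \<in> C i" for p q i
    using h[of p q] diameter_bounded_bound[OF C(2) that] by linarith
  have "bounded (h ` C i)" for i
    unfolding bounded_two_points using d[of _ i] by blast
  moreover have "diameter (h ` C i) \<le> diameter (C i)" for i
    using d[of _ i] diameter_ge_0[OF C(2)] by (intro diameter_le) (auto simp: dist_norm)
  then have "(\<Sum>i. ennreal (diameter (h ` C i))) \<le> (\<Sum>i. ennreal (diameter (C i)))"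
    by (intro suminf_le) (auto simp: ennreal_leI)
  then have "(\<Sum>i. ennreal (diameter (h ` C i))) \<le> ennreal e"
    using C(3) by (rule order_trans)
  moreover have "h ` A \<subseteq> (\<Union>i. h ` C i)"
    using image_mono[OF C(1), of h] by (simp only: image_UN)
  ultimately show "\<exists>C. h ` A \<subseteq> (\<Union>i::nat. C i) \<and> (\<forall>i. bounded (C i)) \<and>
      (\<Sum>i. ennreal (diameter (C i))) \<le> ennreal e"
    by (intro exI[of _ "\<lambda>i. h ` C i"] conjI allI)
qed

text \<open>Outer regularity provides an open set around \<open>W\<close> of measure still at most
  \<open>e\<close>, and the covering lemma supplies nonoverlapping closed intervals inside it.
  Intervals given by their endpoints are what a monotone map can transport.\<close>

lemma bounded_lmeasurable_interval_cover:
  fixes W :: "real set"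
  assumes "bounded W" "W \<in> sets lebesgue" "emeasure lebesgue W < ennreal e"
  obtains a b :: "nat \<Rightarrow> real" where "\<And>i. a i \<le> b i" "W \<subseteq> (\<Union>i. {a i..b i})"
    "(\<Sum>i. ennreal (b i - a i)) \<le> ennreal e"
proof -
  obtain d where d: "emeasure lebesgue W + ennreal d < ennreal e" "d > 0"
  proof -
    obtain w where w: "emeasure lebesgue W = ennreal w" "w \<ge> 0"
      using assms(3) by (cases "emeasure lebesgue W") auto
    then have "w < e"
      using assms(3) by (simp add: ennreal_less_iff)
    then have "emeasure lebesgue W + ennreal ((e - w) / 2) < ennreal e"
      using w by (simp flip: ennreal_plus add: ennreal_less_iff field_simps)
    with \<open>w < e\<close> show thesis
      by (intro that[of "(e - w) / 2"]) auto
  qed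
  obtain G where G: "open G" "W \<subseteq> G" "G - W \<in> lmeasurable" "emeasure lebesgue (G - W) < ennreal d"
    using sets_lebesgue_outer_open[OF assms(2) d(2)] by metis
  have "emeasure lebesgue G \<le> emeasure lebesgue (W \<union> (G - W))"
    using G assms by (intro emeasure_mono) auto
  also have "\<dots> \<le> emeasure lebesgue W + emeasure lebesgue (G - W)"
    using G assms by (intro emeasure_subadditive) auto
  also have "\<dots> \<le> emeasure lebesgue W + ennreal d"
    using G(4) by (intro add_left_mono) auto
  finally have Ge: "emeasure lebesgue G \<le> ennreal e"
    using d(1) by auto
  obtain R where R: "W \<subseteq> {-R..R}" "R > 0"
    using assms(1) by (auto simp: bounded_pos abs_le_iff minus_le_iff subset_iff)
  have "\<exists>r>0. x \<in> G \<longrightarrow> ball x r \<subseteq> G" for x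
    using \<open>open G\<close> openE zero_less_one by metis
  then obtain r where r: "\<And>x. r x > 0" "\<And>x. x \<in> G \<Longrightarrow> ball x (r x) \<subseteq> G"
    by metis
  have g: "gauge (\<lambda>x. ball x (r x))"
    using r by (simp add: gauge_def)
  obtain \<D> where D: "countable \<D>" "\<And>K. K \<in> \<D> \<Longrightarrow> interior K \<noteq> {} \<and> (\<exists>c d. K = cbox c d)"
    "pairwise (\<lambda>A B. interior A \<inter> interior B = {}) \<D>"
    "\<And>K. K \<in> \<D> \<Longrightarrow> \<exists>x \<in> W \<inter> K. K \<subseteq> ball x (r x)" "W \<subseteq> \<Union>\<D>"
  proof (rule covering_lemma[of W "-R" R "\<lambda>x. ball x (r x)"])
    show "W \<subseteq> cbox (- R) R" "box (- R) R \<noteq> {}"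
      using R by simp_all
  qed (rule g, rule that)
  have "\<exists>a b. a \<le> b \<and> K = {a..b}" if K: "K \<in> \<D>" for K
  proof -
    obtain c d where "K = {c..d}" "interior K \<noteq> {}"
      using D(2)[OF K] by (metis cbox_interval)
    then have "c \<le> d"
      using interior_subset by fastforce
    then show ?thesis
      using \<open>K = {c..d}\<close> by blast
  qed
  then obtain A B where AB: "\<And>K. K \<in> \<D> \<Longrightarrow> A K \<le> B K \<and> K = {A K..B K}"
    by metis
  define J where "J = to_nat_on \<D> ` \<D>"
  \<comment> \<open>An index that names no cell gets the interval from 0 to 0: its length is 0 and
    its interior empty, so neither the sum nor the disjointness is affected.\<close>
  define a where "a i = (if i \<in> J then A (from_nat_into \<D> i) else 0)" for i
  define b where "b i = (if i \<in> J then B (from_nat_into \<D> i) else 0)" for i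
  have J: "from_nat_into \<D> i \<in> \<D>" if "i \<in> J" for i
    using that from_nat_into[of \<D> i] unfolding J_def by blast
  have ab: "a i \<le> b i" for i
    using AB J by (auto simp: a_def b_def)
  have int: "{a i<..<b i} = interior (from_nat_into \<D> i)" if "i \<in> J" for i
    using AB[OF J[OF that]] that by (metis a_def b_def interior_atLeastAtMost_real)
  have disj: "disjoint_family (\<lambda>i. {a i<..<b i})"
    unfolding disjoint_family_on_def
  proof (intro ballI impI)
    fix i j :: nat assume "i \<noteq> j"
    show "{a i<..<b i} \<inter> {a j<..<b j} = {}"
    proof (cases "i \<in> J \<and> j \<in> J")
      case True
      then have "from_nat_into \<D> i \<noteq> from_nat_into \<D> j"
        using \<open>i \<noteq> j\<close> D(1) by (auto simp: J_def)
      then show ?thesis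
        using D(3) J True int unfolding pairwise_def by metis
    next
      case False
      then show ?thesis
        by (auto simp: a_def b_def)
    qed
  qed
  have sub: "(\<Union>i. {a i<..<b i}) \<subseteq> G"
  proof clarify
    fix x i assume x: "x \<in> {a i<..<b i}"
    then have "i \<in> J"
      by (auto simp: a_def b_def split: if_splits)
    then have "x \<in> from_nat_into \<D> i"
      using int interior_subset x by blast
    with D(4)[OF J[OF \<open>i \<in> J\<close>]] r G(2) show "x \<in> G"
      by blast
  qed
  \<comment> \<open>Neighbouring cells may share endpoints; the lengths are therefore added over the
    disjoint open interiors.\<close>
  have "(\<Sum>i. ennreal (b i - a i)) = (\<Sum>i. emeasure lborel {a i<..<b i})"
    using ab by simp
  also have "\<dots> = emeasure lborel (\<Union>i. {a i<..<b i})"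
    using disj by (intro suminf_emeasure) auto
  also have "\<dots> \<le> emeasure lborel G"
    using sub G by (intro emeasure_mono) auto
  also have "\<dots> \<le> ennreal e"
    using Ge G by simp
  finally have sum: "(\<Sum>i. ennreal (b i - a i)) \<le> ennreal e" .
  have "W \<subseteq> (\<Union>i. {a i..b i})"
  proof
    fix x assume "x \<in> W"
    then obtain K where K: "K \<in> \<D>" "x \<in> K"
      using D(5) by blast
    define i where "i = to_nat_on \<D> K"
    have "i \<in> J" "from_nat_into \<D> i = K"
      using K D(1) by (auto simp: J_def i_def)
    then have "{a i..b i} = K"
      using AB[OF K(1)] by (simp add: a_def b_def)
    then show "x \<in> (\<Union>i. {a i..b i})"
      using K by blast
  qed
  then show thesis
    using that ab sum by blast
qed

lemma hausdorff1_null_lipschitz_image: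
  fixes h :: "real \<Rightarrow> real \<times> real"
  assumes "negligible N" "bounded N" "L-lipschitz_on N h"
  shows "hausdorff1 (h ` N) = 0"
proof (rule hausdorff1_eq_0I)
  fix e :: real assume "e > 0"
  have L: "L \<ge> 0"
    using assms(3) lipschitz_on_nonneg by blast
  \<comment> \<open>\<open>L\<close> may be 0, so \<open>e\<close> is divided by the positive number
    \<open>L + 1\<close>.\<close>
  define K where "K = L + 1"
  have K: "K > 0" "L \<le> K"
    using L by (auto simp: K_def)
  have N: "N \<in> sets lebesgue" "emeasure lebesgue N < ennreal (e / K)"
    using assms(1) \<open>e > 0\<close> K by (auto simp: negligible_iff_null_sets null_sets_def)
  obtain a b :: "nat \<Rightarrow> real" where ab: "\<And>i. a i \<le> b i" "N \<subseteq> (\<Union>i. {a i..b i})"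
    "(\<Sum>i. ennreal (b i - a i)) \<le> ennreal (e / K)"
    by (rule bounded_lmeasurable_interval_cover[OF assms(2) N]) (rule that)
  have d: "dist (h x) (h y) \<le> L * (b i - a i)" if "x \<in> N \<inter> {a i..b i}" "y \<in> N \<inter> {a i..b i}" for i x y
  proof -
    have "dist (h x) (h y) \<le> L * dist x y"
      using that assms(3) by (auto simp: lipschitz_on_def)
    also have "\<dots> \<le> L * (b i - a i)"
      using that L by (intro mult_left_mono) (auto simp: dist_real_def)
    finally show ?thesis .
  qed
  have bdd: "bounded (h ` (N \<inter> {a i..b i}))" for i
    unfolding bounded_two_points using d[of _ i] by blast
  have diam: "diameter (h ` (N \<inter> {a i..b i})) \<le> L * (b i - a i)" for i
    using d[of _ i] L ab(1)[of i] by (intro diameter_le) (auto simp: dist_norm)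
  have "(\<Sum>i. ennreal (diameter (h ` (N \<inter> {a i..b i})))) \<le> (\<Sum>i. ennreal K * ennreal (b i - a i))"
  proof (intro suminf_le)
    fix i
    have "diameter (h ` (N \<inter> {a i..b i})) \<le> K * (b i - a i)"
      using diam[of i] mult_right_mono[OF K(2), of "b i - a i"] ab(1)[of i] by linarith
    then show "ennreal (diameter (h ` (N \<inter> {a i..b i}))) \<le> ennreal K * ennreal (b i - a i)"
      using K ab(1)[of i] by (simp flip: ennreal_mult add: ennreal_leI)
  qed auto
  also have "\<dots> = ennreal K * (\<Sum>i. ennreal (b i - a i))"
    by simp
  also have "\<dots> \<le> ennreal K * ennreal (e / K)"
    by (intro mult_left_mono ab) auto
  also have "\<dots> = ennreal e"
    using K \<open>e > 0\<close> by (simp flip: ennreal_mult)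
  finally have "(\<Sum>i. ennreal (diameter (h ` (N \<inter> {a i..b i})))) \<le> ennreal e" .
  then show "\<exists>C. h ` N \<subseteq> (\<Union>i::nat. C i) \<and> (\<forall>i. bounded (C i)) \<and>
             (\<Sum>i. ennreal (diameter (C i))) \<le> ennreal e"
    using bdd ab(2) by (intro exI[of _ "\<lambda>i. h ` (N \<inter> {a i..b i})"] conjI allI) blast+
qed

section \<open>Differentiation and density points on the line\<close>

text \<open>The outer measure \<open>\<nu>\<close> of \<open>S\<close> is at most
  \<open>\<theta>\<close> times the measure of any open \<open>G\<close> around \<open>S\<close>;
  the infimum over \<open>G\<close> gives \<open>\<nu> \<le> \<theta> * \<nu>\<close>, hence 0.
  Outer measure spares a proof that the sets of bad points are measurable.\<close>

lemma negligible_if_contracting_covers: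
  fixes S :: "real set"
  assumes "bounded S" "0 \<le> \<theta>" "\<theta> < 1"
    and cover: "\<And>G. \<lbrakk>open G; S \<subseteq> G; emeasure lborel G < \<infinity>\<rbrakk> \<Longrightarrow>
      \<exists>T\<in>sets lebesgue. S \<subseteq> T \<and> emeasure lebesgue T \<le> ennreal \<theta> * emeasure lborel G"
  shows "negligible S"
proof -
  define \<G> where "\<G> = {G. open G \<and> S \<subseteq> G}"
  define \<nu> where "\<nu> = (INF G\<in>\<G>. emeasure lborel G)"
  obtain R where R: "S \<subseteq> ball 0 R"
    using assms(1) bounded_subset_ballD by blast
  have "\<nu> \<le> emeasure lborel (ball 0 R :: real set)"
    unfolding \<nu>_def using R by (intro INF_lower) (auto simp: \<G>_def)
  then have fin: "\<nu> < \<infinity>"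
    using emeasure_bounded_finite[OF bounded_ball, of "0::real" R] by (simp add: le_less_trans)
  have \<nu>_le: "\<nu> \<le> emeasure lebesgue T" if T: "T \<in> sets lebesgue" "S \<subseteq> T" for T
  proof (rule ennreal_le_epsilon)
    fix e :: real assume "e > 0"
    obtain G where G: "open G" "T \<subseteq> G" "G - T \<in> lmeasurable" "emeasure lebesgue (G - T) < ennreal e"
      using sets_lebesgue_outer_open[OF T(1) \<open>e > 0\<close>] by metis
    have "\<nu> \<le> emeasure lborel G"
      unfolding \<nu>_def using G T by (intro INF_lower) (auto simp: \<G>_def)
    also have "\<dots> = emeasure lebesgue (T \<union> (G - T))"
      using G by (simp add: Un_absorb1)
    also have "\<dots> \<le> emeasure lebesgue T + emeasure lebesgue (G - T)"
      using G T by (intro emeasure_subadditive) auto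
    also have "\<dots> \<le> emeasure lebesgue T + ennreal e"
      using G(4) by (intro add_left_mono) auto
    finally show "\<nu> \<le> emeasure lebesgue T + ennreal e" .
  qed
  have "\<nu> = 0"
  proof (rule ccontr)
    assume "\<nu> \<noteq> 0"
    obtain n where n: "\<nu> = ennreal n" "n > 0"
      using fin \<open>\<nu> \<noteq> 0\<close> by (cases \<nu>) (auto simp: less_le)
    \<comment> \<open>Because \<open>\<theta> < 1\<close>, this \<open>k\<close> satisfies both
      \<open>n < k\<close> and \<open>\<theta> * k < n\<close>: an open set of measure below
      \<open>k\<close> exists and yields a cover of measure below \<open>n\<close>.\<close>
    define k where "k = 2 * n / (1 + \<theta>)"
    have "n < k" "\<theta> * k < n"
      using n assms(2,3) by (auto simp: k_def field_simps)
    then have "\<nu> < ennreal k"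
      using n by (simp add: ennreal_less_iff)
    then obtain G where G: "open G" "S \<subseteq> G" "emeasure lborel G < ennreal k"
      unfolding \<nu>_def INF_less_iff \<G>_def by auto
    then have "emeasure lborel G < \<infinity>"
      using ennreal_less_top order_less_trans by (metis infinity_ennreal_def)
    then obtain T where T: "T \<in> sets lebesgue" "S \<subseteq> T" "emeasure lebesgue T \<le> ennreal \<theta> * emeasure lborel G"
      using cover[OF G(1,2)] by blast
    have "\<nu> \<le> ennreal \<theta> * ennreal k"
      using \<nu>_le[OF T(1,2)] T(3) G(3) by (meson less_imp_le mult_left_mono order_trans zero_le)
    also have "\<dots> = ennreal (\<theta> * k)"
      using assms(2) by (simp add: ennreal_mult')
    also have "\<dots> < ennreal n"
      using \<open>\<theta> * k < n\<close> n by (simp add: ennreal_lessI)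
    finally show False
      using n by simp
  qed
  show ?thesis
    unfolding negligible_outer
  proof (intro allI impI)
    fix e :: real assume "e > 0"
    then have "\<nu> < ennreal e"
      using \<open>\<nu> = 0\<close> by simp
    then obtain G where G: "open G" "S \<subseteq> G" "emeasure lborel G < ennreal e"
      unfolding \<nu>_def INF_less_iff \<G>_def by auto
    then have "G \<in> lmeasurable"
      by (intro fmeasurableI) (auto intro: order_less_trans)
    moreover have "measure lebesgue G < e"
      using G(1,3) \<open>e > 0\<close> \<open>G \<in> lmeasurable\<close> emeasure_eq_measure2[of G lebesgue]
      by (simp add: ennreal_less_iff)
    ultimately show "\<exists>T. S \<subseteq> T \<and> T \<in> lmeasurable \<and> measure lebesgue T < e"
      using G(2) by blast
  qed
qed

text \<open>An interval is the ball around its midpoint, so Vitali's theorem for balls applies. The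
  point \<open>u\<close> may sit anywhere in the interval, even at an end, as it does in difference
  quotients at \<open>u\<close>.\<close>

lemma Vitali_intervals:
  fixes S G :: "real set"
  assumes "open G" "S \<subseteq> G"
    and fine: "\<And>u e. \<lbrakk>u \<in> S; e > 0\<rbrakk> \<Longrightarrow> \<exists>s t. s < t \<and> s \<le> u \<and> u \<le> t \<and> t - s < e \<and> P s t"
  obtains C where "countable C" "\<And>s t. (s, t) \<in> C \<Longrightarrow> s < t \<and> P s t \<and> {s..t} \<subseteq> G"
    "disjoint_family_on (\<lambda>(s, t). {s..t}) C" "negligible (S - (\<Union>(s, t)\<in>C. {s..t}))"
proof -
  define K where "K = {(s, t). s < t \<and> P s t \<and> {s..t} \<subseteq> G}"
  define a where "a = (\<lambda>(s, t). (s + t) / 2 :: real)"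
  define r where "r = (\<lambda>(s, t). (t - s) / 2 :: real)"
  have cb: "cball (a (s, t)) (r (s, t)) = {s..t}" for s t
    by (auto simp: a_def r_def cball_eq_atLeastAtMost field_simps)
  have "\<exists>i. i \<in> K \<and> x \<in> cball (a i) (r i) \<and> r i < d" if x: "x \<in> S" "0 < d" for x d
  proof -
    obtain e where e: "e > 0" "ball x e \<subseteq> G"
      using assms(1,2) x openE by blast
    obtain s t where st: "s < t" "s \<le> x" "x \<le> t" "t - s < min d e" "P s t"
      using fine[OF x(1), of "min d e"] x(2) e(1) by auto
    have "{s..t} \<subseteq> ball x e"
      using st by (auto simp: dist_real_def)
    then have "(s, t) \<in> K"
      using st e by (auto simp: K_def)
    moreover have "r (s, t) < d"
      using st by (auto simp: r_def)
    ultimately show ?thesis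
      using st cb[of s t] by (intro exI[of _ "(s, t)"]) auto
  qed
  moreover have "0 < r i" if "i \<in> K" for i
    using that by (auto simp: K_def r_def)
  ultimately obtain C where C: "countable C" "C \<subseteq> K"
     "pairwise (\<lambda>i j. disjnt (cball (a i) (r i)) (cball (a j) (r j))) C"
     "negligible (S - (\<Union>i \<in> C. cball (a i) (r i)))"
    using Vitali_covering_theorem_cballs[of K r S a] by blast
  have cb': "cball (a i) (r i) = (case i of (s, t) \<Rightarrow> {s..t})" for i
    using cb by (cases i) auto
  show thesis
  proof
    show "countable C" by fact
    show "s < t \<and> P s t \<and> {s..t} \<subseteq> G" if "(s, t) \<in> C" for s t
      using that C(2) by (auto simp: K_def)
    show "disjoint_family_on (\<lambda>(s, t). {s..t}) C"
      using C(3) unfolding cb' by (simp add: disjoint_family_on_def pairwise_def disjnt_def)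
    show "negligible (S - (\<Union>(s, t)\<in>C. {s..t}))"
      using C(4) unfolding cb' .
  qed
qed

text \<open>Discarding the countably many endpoints makes \<open>V\<close> open, so that another
  Vitali selection can be carried out inside \<open>V\<close>.\<close>

lemma Vitali_measure_le:
  fixes S G :: "real set" and M :: "real measure"
  assumes "open G" "S \<subseteq> G" and [measurable_cong]: "sets M = sets borel"
    and fine: "\<And>u e. \<lbrakk>u \<in> S; e > 0\<rbrakk> \<Longrightarrow>
      \<exists>s t. s < t \<and> s \<le> u \<and> u \<le> t \<and> t - s < e \<and> emeasure M {s..t} \<le> ennreal p * ennreal (t - s)"
  obtains V where "open V" "V \<subseteq> G" "negligible (S - V)" "emeasure M V \<le> ennreal p * emeasure lborel V"
proof -
  obtain C where C: "countable C"
    "\<And>s t. (s, t) \<in> C \<Longrightarrow> s < t \<and> emeasure M {s..t} \<le> ennreal p * ennreal (t - s) \<and> {s..t} \<subseteq> G"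
    "disjoint_family_on (\<lambda>(s, t). {s..t}) C" "negligible (S - (\<Union>(s, t)\<in>C. {s..t}))"
    by (rule Vitali_intervals[OF assms(1,2) fine]) (assumption | rule that)+
  define V where "V = (\<Union>(s, t)\<in>C. {s<..<t})"
  have disj: "disjoint_family_on (\<lambda>(s, t). {s<..<t}) C"
    using C(3) unfolding disjoint_family_on_def by (fastforce simp: less_imp_le)
  have "negligible (\<Union>(s, t)\<in>C. {s, t})"
    using C(1) by (intro negligible_countable_Union) (auto simp: case_prod_beta)
  then have "negligible ((S - (\<Union>(s, t)\<in>C. {s..t})) \<union> (\<Union>(s, t)\<in>C. {s, t}))"
    using C(4) negligible_Un by blast
  moreover have "S - V \<subseteq> (S - (\<Union>(s, t)\<in>C. {s..t})) \<union> (\<Union>(s, t)\<in>C. {s, t})"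
    unfolding V_def by force
  ultimately have "negligible (S - V)"
    using negligible_subset by blast
  moreover have "open V"
    unfolding V_def by (auto intro!: open_UN)
  moreover have "V \<subseteq> G"
    using C(2) unfolding V_def by force
  moreover have "emeasure M V \<le> ennreal p * emeasure lborel V"
  proof -
    have "emeasure M V = (\<integral>\<^sup>+i. emeasure M ((\<lambda>(s, t). {s<..<t}) i) \<partial>count_space C)"
      unfolding V_def using C(1) disj by (intro emeasure_UN_countable) (auto simp: assms(3))
    also have "\<dots> \<le> (\<integral>\<^sup>+i. ennreal p * emeasure lborel ((\<lambda>(s, t). {s<..<t}) i) \<partial>count_space C)"
    proof (rule nn_integral_mono)
      fix i assume "i \<in> space (count_space C)"
      then obtain s t where i: "i = (s, t)" "(s, t) \<in> C"
        by (cases i) auto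
      have "emeasure M {s<..<t} \<le> emeasure M {s..t}"
        by (intro emeasure_mono) (auto simp: assms(3))
      also have "\<dots> \<le> ennreal p * emeasure lborel {s<..<t}"
        using C(2)[OF i(2)] by simp
      finally show "emeasure M ((\<lambda>(s, t). {s<..<t}) i) \<le> ennreal p * emeasure lborel ((\<lambda>(s, t). {s<..<t}) i)"
        using i by simp
    qed
    also have "\<dots> = ennreal p * (\<integral>\<^sup>+i. emeasure lborel ((\<lambda>(s, t). {s<..<t}) i) \<partial>count_space C)"
      by (intro nn_integral_cmult) auto
    also have "\<dots> = ennreal p * emeasure lborel V"
      unfolding V_def using C(1) disj by (subst emeasure_UN_countable) auto
    finally show ?thesis .
  qed
  ultimately show thesis
    using that by blast
qed

text \<open>Here the intervals stay closed and \<open>T\<close> is merely Borel: \<open>M\<close>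
  may charge endpoints, and removing them could destroy the lower bound.\<close>

lemma Vitali_measure_ge:
  fixes S G :: "real set" and M :: "real measure"
  assumes "open G" "S \<subseteq> G" and [measurable_cong]: "sets M = sets borel"
    and fine: "\<And>u e. \<lbrakk>u \<in> S; e > 0\<rbrakk> \<Longrightarrow>
      \<exists>s t. s < t \<and> s \<le> u \<and> u \<le> t \<and> t - s < e \<and> ennreal q * ennreal (t - s) \<le> emeasure M {s..t}"
  obtains T where "T \<in> sets borel" "T \<subseteq> G" "negligible (S - T)" "ennreal q * emeasure lborel T \<le> emeasure M T"
proof -
  obtain C where C: "countable C"
    "\<And>s t. (s, t) \<in> C \<Longrightarrow> s < t \<and> ennreal q * ennreal (t - s) \<le> emeasure M {s..t} \<and> {s..t} \<subseteq> G"
    "disjoint_family_on (\<lambda>(s, t). {s..t}) C" "negligible (S - (\<Union>(s, t)\<in>C. {s..t}))"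
    by (rule Vitali_intervals[OF assms(1,2) fine]) (assumption | rule that)+
  define T where "T = (\<Union>(s, t)\<in>C. {s..t})"
  have "T \<in> sets borel"
    unfolding T_def using C(1) by (intro sets.countable_UN') auto
  moreover have "T \<subseteq> G"
    using C(2) unfolding T_def by force
  moreover have "ennreal q * emeasure lborel T \<le> emeasure M T"
  proof -
    have "ennreal q * emeasure lborel T = ennreal q * (\<integral>\<^sup>+i. emeasure lborel ((\<lambda>(s, t). {s..t}) i) \<partial>count_space C)"
      unfolding T_def using C(1,3) by (subst emeasure_UN_countable) auto
    also have "\<dots> = (\<integral>\<^sup>+i. ennreal q * emeasure lborel ((\<lambda>(s, t). {s..t}) i) \<partial>count_space C)"
      by (intro nn_integral_cmult[symmetric]) auto
    also have "\<dots> \<le> (\<integral>\<^sup>+i. emeasure M ((\<lambda>(s, t). {s..t}) i) \<partial>count_space C)"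
      using C(2) by (intro nn_integral_mono) (auto split: prod.split simp: less_imp_le)
    also have "\<dots> = emeasure M T"
      unfolding T_def using C(1,3) by (intro emeasure_UN_countable[symmetric]) (auto simp: assms(3))
    finally show ?thesis .
  qed
  ultimately show thesis
    using that C(4) unfolding T_def by blast
qed

text \<open>Lebesgue's density theorem, for intervals placed arbitrarily around the point. With
  \<open>M\<close> as Lebesgue measure restricted to \<open>U\<close>, almost all of the bad set
  lies in \<open>U \<inter> V\<close>, whose measure is at most \<open>p\<close> times that of
  \<open>V\<close>: a contraction by \<open>p\<close>.\<close>

lemma negligible_low_density_points:
  fixes U :: "real set"
  assumes U: "U \<in> sets borel" "bounded U" and p: "0 \<le> p" "p < 1"
  shows "negligible {u\<in>U. \<forall>e>0. \<exists>s t. s < t \<and> s \<le> u \<and> u \<le> t \<and> t - s < e \<and>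
    measure lborel (U \<inter> {s..t}) \<le> p * (t - s)}" (is "negligible ?S")
proof (rule negligible_if_contracting_covers[OF _ p])
  show "bounded ?S"
    using U(2) by (rule bounded_subset) auto
next
  fix G assume G: "open G" "?S \<subseteq> G" "emeasure lborel G < \<infinity>"
  define M where "M = density lborel (indicator U :: real \<Rightarrow> ennreal)"
  have M: "emeasure M A = emeasure lborel (U \<inter> A)" if "A \<in> sets borel" for A
    using U(1) that unfolding M_def by (subst emeasure_restricted) auto
  have sM: "sets M = sets borel"
    by (simp add: M_def)
  have low: "\<exists>s t. s < t \<and> s \<le> u \<and> u \<le> t \<and> t - s < e \<and> emeasure M {s..t} \<le> ennreal p * ennreal (t - s)"
    if u: "u \<in> ?S" "e > 0" for u e
  proof -
    obtain s t where st: "s < t" "s \<le> u" "u \<le> t" "t - s < e"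
      and le: "measure lborel (U \<inter> {s..t}) \<le> p * (t - s)"
      using u by auto
    have "emeasure lborel (U \<inter> {s..t}) \<noteq> \<infinity>"
      using emeasure_bounded_finite[of "U \<inter> {s..t}"] U(2) by (auto simp: bounded_Int)
    then have "emeasure lborel (U \<inter> {s..t}) = ennreal (measure lborel (U \<inter> {s..t}))"
      by (simp add: emeasure_eq_ennreal_measure)
    also have "\<dots> \<le> ennreal p * ennreal (t - s)"
      using le p st by (simp flip: ennreal_mult add: ennreal_leI)
    finally show ?thesis
      using M[of "{s..t}"] st by (intro exI[of _ s] exI[of _ t]) simp
  qed
  obtain V where V: "open V" "V \<subseteq> G" "negligible (?S - V)"
    "emeasure M V \<le> ennreal p * emeasure lborel V"
    using Vitali_measure_le[OF G(1,2) sM low] by blast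
  have "emeasure lebesgue ((U \<inter> V) \<union> (?S - V)) = emeasure lebesgue (U \<inter> V)"
    using V U by (intro emeasure_Un_null_set) (auto simp: negligible_iff_null_sets)
  also have "\<dots> = emeasure M V"
    using M[of V] V(1) U(1) by simp
  also note V(4)
  also have "ennreal p * emeasure lborel V \<le> ennreal p * emeasure lborel G"
    using V(2) G(1) by (intro mult_left_mono emeasure_mono) auto
  finally have "emeasure lebesgue ((U \<inter> V) \<union> (?S - V)) \<le> ennreal p * emeasure lborel G" .
  moreover have "(U \<inter> V) \<union> (?S - V) \<in> sets lebesgue"
    using V U by (intro sets.Un) (auto simp: negligible_imp_sets)
  ultimately show "\<exists>T\<in>sets lebesgue. ?S \<subseteq> T \<and> emeasure lebesgue T \<le> ennreal p * emeasure lborel G"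
    by (intro bexI[of _ "(U \<inter> V) \<union> (?S - V)"]) auto
qed

text \<open>Two selections are nested: flat intervals give \<open>V\<close>, whose Stieltjes measure
  is at most \<open>p\<close> times its length, and steep intervals inside \<open>V\<close> give
  \<open>T\<close>, whose Stieltjes measure is at least \<open>q\<close> times its length. Comparing
  them contracts by \<open>p / q\<close>.\<close>

lemma negligible_oscillating_slope:
  fixes F :: "real \<Rightarrow> real" and U :: "real set"
  assumes "mono F" "continuous_on UNIV F" "bounded U" and pq: "0 \<le> p" "p < q"
  shows "negligible {u\<in>U.
    (\<forall>e>0. \<exists>s t. s < t \<and> s \<le> u \<and> u \<le> t \<and> t - s < e \<and> F t - F s \<le> p * (t - s)) \<and>
    (\<forall>e>0. \<exists>s t. s < t \<and> s \<le> u \<and> u \<le> t \<and> t - s < e \<and> q * (t - s) \<le> F t - F s)}"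
    (is "negligible ?S")
proof (rule negligible_if_contracting_covers[where \<theta> = "p / q"])
  show "bounded ?S"
    using assms(3) by (rule bounded_subset) auto
  show "0 \<le> p / q" "p / q < 1"
    using pq by auto
next
  fix G assume G: "open G" "?S \<subseteq> G" "emeasure lborel G < \<infinity>"
  define M where "M = interval_measure F"
  have M: "emeasure M {s..t} = ennreal (F t - F s)" if "s < t" for s t
    using that assms(1,2) unfolding M_def
    by (intro emeasure_interval_measure_Icc) (auto simp: monoD)
  have low: "\<exists>s t. s < t \<and> s \<le> u \<and> u \<le> t \<and> t - s < e \<and> emeasure M {s..t} \<le> ennreal p * ennreal (t - s)"
    if u: "u \<in> ?S" "e > 0" for u e
  proof -
    obtain s t where st: "s < t" "s \<le> u" "u \<le> t" "t - s < e" "F t - F s \<le> p * (t - s)"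
      using u by auto
    then have "emeasure M {s..t} \<le> ennreal p * ennreal (t - s)"
      using M[of s t] pq by (simp flip: ennreal_mult add: ennreal_leI)
    with st show ?thesis by blast
  qed
  have high: "\<exists>s t. s < t \<and> s \<le> u \<and> u \<le> t \<and> t - s < e \<and> ennreal q * ennreal (t - s) \<le> emeasure M {s..t}"
    if u: "u \<in> ?S" "e > 0" for u e
  proof -
    obtain s t where st: "s < t" "s \<le> u" "u \<le> t" "t - s < e" "q * (t - s) \<le> F t - F s"
      using u by auto
    then have "ennreal q * ennreal (t - s) \<le> emeasure M {s..t}"
      using M[of s t] pq by (simp flip: ennreal_mult add: ennreal_leI)
    with st show ?thesis by blast
  qed
  have sM: "sets M = sets borel"
    by (simp add: M_def)
  obtain V where V: "open V" "V \<subseteq> G" "negligible (?S - V)"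
    "emeasure M V \<le> ennreal p * emeasure lborel V"
    using Vitali_measure_le[OF G(1,2) sM low] by blast
  obtain T where T: "T \<in> sets borel" "T \<subseteq> V" "negligible (?S \<inter> V - T)"
    "ennreal q * emeasure lborel T \<le> emeasure M T"
  proof (rule Vitali_measure_ge[OF V(1) _ sM, of "?S \<inter> V" q])
    show "\<exists>s t. s < t \<and> s \<le> u \<and> u \<le> t \<and> t - s < e \<and> ennreal q * ennreal (t - s) \<le> emeasure M {s..t}"
      if "u \<in> ?S \<inter> V" "e > 0" for u e
      using high[of u e] that by blast
  qed (auto intro: that)
  define N where "N = (?S - V) \<union> (?S \<inter> V - T)"
  have N: "negligible N"
    using V(3) T(3) unfolding N_def by (rule negligible_Un)
  note T(4)
  also have "emeasure M T \<le> emeasure M V"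
    using T V(1) sM by (intro emeasure_mono) auto
  also note V(4)
  also have "ennreal p * emeasure lborel V \<le> ennreal p * emeasure lborel G"
    using V(2) G(1) by (intro mult_left_mono emeasure_mono) auto
  finally have "ennreal (1 / q) * (ennreal q * emeasure lborel T) \<le> ennreal (1 / q) * (ennreal p * emeasure lborel G)"
    by (intro mult_left_mono) auto
  then have "emeasure lborel T \<le> ennreal (p / q) * emeasure lborel G"
    using pq by (simp flip: mult.assoc ennreal_mult)
  moreover have "emeasure lebesgue (T \<union> N) = emeasure lborel T"
    using N T by (subst emeasure_Un_null_set) (auto simp: negligible_iff_null_sets)
  moreover have "T \<union> N \<in> sets lebesgue"
    using N T(1) by (intro sets.Un) (auto simp: negligible_imp_sets)
  ultimately show "\<exists>T\<in>sets lebesgue. ?S \<subseteq> T \<and> emeasure lebesgue T \<le> ennreal (p / q) * emeasure lborel G"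
    by (intro bexI[of _ "T \<union> N"]) (auto simp: N_def)
qed

text \<open>Lebesgue's theorem for monotone functions. The Lipschitz bound keeps all quotients in
  [0,1], so at a bad point the lower and upper limits are finite and different, and a pair of
  rationals fits between them; each such pair contributes a null set.\<close>

lemma negligible_nondifferentiable:
  fixes F :: "real \<Rightarrow> real" and U :: "real set"
  assumes "mono F" "1-lipschitz_on UNIV F" "bounded U"
  shows "negligible {u\<in>U. \<not> F differentiable (at u)}"
proof -
  define Q where "Q = {(p, q). p \<in> \<rat> \<and> q \<in> \<rat> \<and> 0 \<le> p \<and> p < (q :: real)}"
  define S where "S = (\<lambda>(p, q). {u\<in>U.
    (\<forall>e>0. \<exists>s t. s < t \<and> s \<le> u \<and> u \<le> t \<and> t - s < e \<and> F t - F s \<le> p * (t - s)) \<and>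
    (\<forall>e>0. \<exists>s t. s < t \<and> s \<le> u \<and> u \<le> t \<and> t - s < e \<and> q * (t - s) \<le> F t - F s)})"
  have cont: "continuous_on UNIV F"
    using assms(2) by (rule lipschitz_on_continuous_on)
  have "countable Q"
    by (rule countable_subset[OF _ countable_SIGMA[OF countable_rat countable_rat]]) (auto simp: Q_def)
  moreover have "negligible (S x)" if "x \<in> Q" for x
    using that negligible_oscillating_slope[OF assms(1) cont assms(3)]
    unfolding Q_def S_def by (cases x) (simp only: mem_Collect_eq case_prod_conv)
  ultimately have "negligible (\<Union>x\<in>Q. S x)"
    by (intro negligible_countable_Union[of "S ` Q"]) auto
  moreover have "u \<in> (\<Union>x\<in>Q. S x)" if u: "u \<in> U" "\<not> F differentiable (at u)" for u
  proof -
    define d where "d t = (F t - F u) / (t - u)" for t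
    have d_swap: "d t = (F u - F t) / (u - t)" for t
      unfolding d_def by (metis minus_diff_eq minus_divide_divide)
    have d0: "0 \<le> d t" for t
      using assms(1) unfolding d_def
      by (cases "t \<le> u") (auto simp: monoD zero_le_divide_iff)
    have d1: "d t \<le> 1" for t
    proof -
      have "\<bar>F t - F u\<bar> \<le> \<bar>t - u\<bar>"
        using assms(2) by (auto simp: lipschitz_on_def dist_real_def)
      then have "\<bar>d t\<bar> \<le> 1"
        unfolding d_def abs_divide by (cases "t = u") (auto simp: field_simps)
      then show ?thesis
        by simp
    qed
    let ?L = "Liminf (at u) (\<lambda>t. ereal (d t))" and ?U = "Limsup (at u) (\<lambda>t. ereal (d t))"
    have L0: "0 \<le> ?L"
      using d0 by (intro Liminf_bounded) auto
    have U1: "?U \<le> 1"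
      using d1 by (intro Limsup_bounded) auto
    have "?L \<le> ?U"
      by (intro Liminf_le_Limsup) auto
    have fin: "x = ereal (real_of_ereal x)" if "0 \<le> x" "x \<le> y" "y \<le> 1" for x y :: ereal
      using that by (cases x; cases y) auto
    have "?L \<noteq> ?U"
    proof
      assume "?L = ?U"
      define l where "l = real_of_ereal ?L"
      have "?L = ereal l"
        using fin[OF L0 \<open>?L \<le> ?U\<close> U1] by (simp add: l_def)
      then have "((\<lambda>t. ereal (d t)) \<longlongrightarrow> ereal l) (at u)"
        using \<open>?L = ?U\<close> by (subst tendsto_iff_Liminf_eq_Limsup) auto
      then have "(d \<longlongrightarrow> l) (at u)"
        by simp
      then have "(F has_real_derivative l) (at u)"
        unfolding has_field_derivative_iff d_def .
      then show False
        using u(2) by (auto simp: real_differentiable_def)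
    qed
    then have "?L < ?U"
      using \<open>?L \<le> ?U\<close> by simp
    then obtain y where y: "?L < ereal y" "ereal y < ?U"
      using ereal_dense2 by blast
    then obtain z where z: "y < z" "ereal z < ?U"
      using ereal_dense2[OF y(2)] by auto
    obtain p q where pq: "p \<in> \<rat>" "q \<in> \<rat>" "y < p" "p < q" "q < z"
      using z(1) Rats_dense_in_real by (metis)
    have p: "?L < ereal p" and q: "ereal q < ?U"
      using less_trans[OF y(1), of "ereal p"] less_trans[OF _ z(2), of "ereal q"] pq by simp_all
    have "0 \<le> p"
      using le_less_trans[OF L0 p] by (simp add: zero_ereal_def)
    have freq_p: "\<exists>\<^sub>F t in at u. d t \<le> p"
    proof (rule ccontr)
      assume "\<not> ?thesis"
      then have "\<forall>\<^sub>F t in at u. ereal p \<le> ereal (d t)"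
        by (simp add: not_frequently not_le eventually_mono)
      then have "ereal p \<le> ?L"
        by (rule Liminf_bounded)
      then show False
        using p by simp
    qed
    have freq_q: "\<exists>\<^sub>F t in at u. q \<le> d t"
    proof (rule ccontr)
      assume "\<not> ?thesis"
      then have "\<forall>\<^sub>F t in at u. ereal (d t) \<le> ereal q"
        by (simp add: not_frequently not_le eventually_mono)
      then have "?U \<le> ereal q"
        by (rule Limsup_bounded)
      then show False
        using q by simp
    qed
    have interval: "\<exists>s t. s < t \<and> s \<le> u \<and> u \<le> t \<and> t - s < e \<and> P ((F t - F s) / (t - s))"
      if fr: "\<exists>\<^sub>F t in at u. P (d t)" and e: "e > 0" for P e
    proof -
      have "\<forall>\<^sub>F t in at u. t \<noteq> u \<and> dist t u < e"
        using e by (auto simp: eventually_at)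
      then obtain t where t: "P (d t)" "t \<noteq> u" "\<bar>t - u\<bar> < e"
        using frequently_ex[OF frequently_eventually_frequently[OF fr]] by (auto simp: dist_real_def)
      show ?thesis
      proof (cases "u < t")
        case True
        with t show ?thesis
          unfolding d_def by (intro exI[of _ u] exI[of _ t]) auto
      next
        case False
        with t show ?thesis
          unfolding d_swap by (intro exI[of _ t] exI[of _ u]) auto
      qed
    qed
    have "u \<in> S (p, q)"
      unfolding S_def
    proof (simp, intro conjI allI impI)
      show "u \<in> U" by fact
      fix e :: real assume "e > 0"
      obtain s t where st: "s < t" "s \<le> u" "u \<le> t" "t - s < e" "(F t - F s) / (t - s) \<le> p"
        using interval[OF freq_p \<open>e > 0\<close>] by blast
      then show "\<exists>s t. s < t \<and> s \<le> u \<and> u \<le> t \<and> t - s < e \<and> F t - F s \<le> p * (t - s)"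
        by (intro exI[of _ s] exI[of _ t]) (simp add: pos_divide_le_eq)
      obtain s t where st: "s < t" "s \<le> u" "u \<le> t" "t - s < e" "q \<le> (F t - F s) / (t - s)"
        using interval[OF freq_q \<open>e > 0\<close>] by blast
      then show "\<exists>s t. s < t \<and> s \<le> u \<and> u \<le> t \<and> t - s < e \<and> q * (t - s) \<le> F t - F s"
        by (intro exI[of _ s] exI[of _ t]) (simp add: pos_le_divide_eq)
    qed
    moreover have "(p, q) \<in> Q"
      using pq \<open>0 \<le> p\<close> by (simp add: Q_def)
    ultimately show ?thesis
      by blast
  qed
  ultimately show ?thesis
    by (auto intro: negligible_subset)
qed

section \<open>Approximate derivatives\<close>

text \<open>A function \<open>J\<close> with \<open>one_sided x J\<close> assigns to \<open>\<delta>\<close> the right or the left open \<open>\<delta>\<close>-neighbourhood of \<open>x\<close>;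
  this treats the left and right derivates simultaneously.\<close>

definition one_sided :: "real \<Rightarrow> (real \<Rightarrow> real set) \<Rightarrow> bool" where
  "one_sided x J \<longleftrightarrow> J = (\<lambda>\<delta>. {x<..<x+\<delta>}) \<or> J = (\<lambda>\<delta>. {x-\<delta><..<x})"

definition full_density :: "real set \<Rightarrow> (real \<Rightarrow> real set) \<Rightarrow> (real \<Rightarrow> bool) \<Rightarrow> bool" where
  "full_density I J P \<longleftrightarrow> ((\<lambda>\<delta>. measure lborel {y \<in> I \<inter> J \<delta>. P y} / \<delta>) \<longlongrightarrow> 1) (at_right 0)"

text \<open>The value \<open>L\<close> may be infinite; one of the two families of conditions is
  then vacuous.\<close>

definition has_ap_deriv :: "(real \<Rightarrow> real) \<Rightarrow> real set \<Rightarrow> real \<Rightarrow> ereal \<Rightarrow> bool" where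
  "has_ap_deriv f I x L \<longleftrightarrow> (\<forall>J. one_sided x J \<longrightarrow>
     (\<forall>t. L < ereal t \<longrightarrow> full_density I J (\<lambda>y. (f y - f x) / (y - x) \<le> t)) \<and>
     (\<forall>t. ereal t < L \<longrightarrow> full_density I J (\<lambda>y. (f y - f x) / (y - x) \<ge> t)))"

lemma one_sided_right: "one_sided x (\<lambda>\<delta>. {x<..<x+\<delta>})"
  and one_sided_left: "one_sided x (\<lambda>\<delta>. {x-\<delta><..<x})"
  by (simp_all add: one_sided_def)

lemma one_sided_open: "one_sided x J \<Longrightarrow> open (J \<delta>)"
  and one_sided_subset: "one_sided x J \<Longrightarrow> J \<delta> \<subseteq> {x-\<delta><..<x+\<delta>} - {x}"
  and one_sided_measure: "one_sided x J \<Longrightarrow> 0 < \<delta> \<Longrightarrow> measure lborel (J \<delta>) = \<delta>"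
  by (auto simp: one_sided_def)

lemma bounded_fmeasurable_lborel:
  fixes A :: "real set"
  shows "bounded A \<Longrightarrow> A \<in> sets borel \<Longrightarrow> A \<in> fmeasurable lborel"
  using emeasure_bounded_finite by (intro fmeasurableI) (auto simp: less_top)

lemma one_sided_fmeasurable: "one_sided x J \<Longrightarrow> J \<delta> \<in> fmeasurable lborel"
  by (rule bounded_fmeasurable_lborel) (auto simp: one_sided_def)

lemma ap_Dini_full_density:
  "ap_upper_right f I x = Inf {ereal t | t. full_density I (\<lambda>\<delta>. {x<..<x+\<delta>}) (\<lambda>y. (f y - f x) / (y - x) \<le> t)}"
  "ap_lower_right f I x = Sup {ereal t | t. full_density I (\<lambda>\<delta>. {x<..<x+\<delta>}) (\<lambda>y. (f y - f x) / (y - x) \<ge> t)}"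
  "ap_upper_left f I x = Inf {ereal t | t. full_density I (\<lambda>\<delta>. {x-\<delta><..<x}) (\<lambda>y. (f y - f x) / (y - x) \<le> t)}"
  "ap_lower_left f I x = Sup {ereal t | t. full_density I (\<lambda>\<delta>. {x-\<delta><..<x}) (\<lambda>y. (f y - f x) / (y - x) \<ge> t)}"
  unfolding full_density_def ap_upper_right_def ap_lower_right_def ap_upper_left_def ap_lower_left_def
  by (rule refl)+

lemma sets_borel_sublevel:
  fixes g :: "real \<Rightarrow> real"
  assumes "open S" "continuous_on S g"
  shows "{y\<in>S. g y \<le> t} \<in> sets borel" "{y\<in>S. g y \<ge> t} \<in> sets borel"
proof -
  have "open (S \<inter> g -` {t<..})" "open (S \<inter> g -` {..<t})"
    using assms by (auto intro: continuous_open_preimage)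
  moreover have "{y\<in>S. g y \<le> t} = S - (S \<inter> g -` {t<..})" "{y\<in>S. g y \<ge> t} = S - (S \<inter> g -` {..<t})"
    by auto
  ultimately show "{y\<in>S. g y \<le> t} \<in> sets borel" "{y\<in>S. g y \<ge> t} \<in> sets borel"
    using assms(1) by auto
qed

lemma eventually_one_sided_subset:
  assumes "x \<in> interior I" "one_sided x J"
  shows "\<forall>\<^sub>F \<delta> in at_right 0. J \<delta> \<subseteq> I"
proof -
  obtain e where e: "e > 0" "ball x e \<subseteq> I"
    using assms(1) mem_interior by blast
  have "\<forall>\<^sub>F \<delta> in at_right 0. \<delta> \<in> {0<..<e}"
    using e(1) by (intro eventually_at_right_real) auto
  then show ?thesis
  proof eventually_elim
    case (elim \<delta>)
    have "J \<delta> \<subseteq> ball x e"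
      using one_sided_subset[OF assms(2), of \<delta>] elim by (force simp: dist_real_def)
    with e show ?case by blast
  qed
qed

text \<open>\<open>measure\<close> is 0 on sets that are not measurable, so density computations
  need these sets to be Borel. Continuity of \<open>f\<close> yields this once the window lies in
  \<open>I\<close>, that is, for small \<open>\<delta>\<close>.\<close>

lemma eventually_sets_quotient:
  fixes f :: "real \<Rightarrow> real"
  assumes "continuous_on I f" "x \<in> interior I" "one_sided x J"
  shows "\<forall>\<^sub>F \<delta> in at_right 0. {y \<in> I \<inter> J \<delta>. (f y - f x) / (y - x) \<le> t} \<in> sets borel"
    "\<forall>\<^sub>F \<delta> in at_right 0. {y \<in> I \<inter> J \<delta>. (f y - f x) / (y - x) \<ge> t} \<in> sets borel"
proof -
  have *: "{y \<in> I \<inter> J \<delta>. (f y - f x) / (y - x) \<le> t} \<in> sets borel \<and>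
     {y \<in> I \<inter> J \<delta>. (f y - f x) / (y - x) \<ge> t} \<in> sets borel" if "J \<delta> \<subseteq> I" for \<delta>
  proof -
    have "I \<inter> J \<delta> = J \<delta>"
      using that by blast
    moreover have "continuous_on (J \<delta>) (\<lambda>y. (f y - f x) / (y - x))"
      using one_sided_subset[OF assms(3), of \<delta>] that
      by (intro continuous_intros continuous_on_subset[OF assms(1)]) auto
    ultimately show ?thesis
      using sets_borel_sublevel[OF one_sided_open[OF assms(3)]] by simp
  qed
  show "\<forall>\<^sub>F \<delta> in at_right 0. {y \<in> I \<inter> J \<delta>. (f y - f x) / (y - x) \<le> t} \<in> sets borel"
    "\<forall>\<^sub>F \<delta> in at_right 0. {y \<in> I \<inter> J \<delta>. (f y - f x) / (y - x) \<ge> t} \<in> sets borel"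
    using eventually_one_sided_subset[OF assms(2,3)] * by (auto elim: eventually_mono)
qed

text \<open>Where \<open>P\<close> fails in a small window, the point lies outside \<open>K\<close>,
  and that part of the window is small compared with \<open>\<delta>\<close>. The set
  \<open>S\<close> restricts the hypothesis on \<open>P\<close> to the side on which
  \<open>J\<close> lives.\<close>

lemma full_density_of_dense_subset:
  assumes x: "x \<in> interior I" and J: "one_sided x J" "\<And>\<delta>. J \<delta> \<subseteq> S"
    and meas: "\<forall>\<^sub>F \<delta> in at_right 0. {y \<in> I \<inter> J \<delta>. P y} \<in> sets borel"
    and K: "K \<in> sets borel" "\<And>\<kappa>. \<kappa> > 0 \<Longrightarrow> \<forall>\<^sub>F \<delta> in at_right 0. measure lborel ({x-\<delta><..<x+\<delta>} - K) \<le> \<kappa> * \<delta>"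
    and P: "\<forall>\<^sub>F y in at x within I \<inter> S. y \<in> K \<longrightarrow> P y"
  shows "full_density I J P"
proof -
  let ?m = "\<lambda>\<delta>. measure lborel {y \<in> I \<inter> J \<delta>. P y}"
  obtain d where d: "d > 0" "\<And>y. \<lbrakk>y \<in> I \<inter> S; y \<noteq> x; dist y x < d; y \<in> K\<rbrakk> \<Longrightarrow> P y"
    using P unfolding eventually_at by auto
  have small: "\<forall>\<^sub>F \<delta> in at_right 0. \<delta> \<in> {0<..<d}"
    using d(1) by (intro eventually_at_right_real) auto
  have upper: "\<forall>\<^sub>F \<delta> in at_right 0. ?m \<delta> / \<delta> \<le> 1"
    using small meas
  proof eventually_elim
    case (elim \<delta>)
    have "?m \<delta> \<le> measure lborel (J \<delta>)"
      using elim J by (intro measure_mono_fmeasurable one_sided_fmeasurable) auto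
    then show ?case
      using one_sided_measure[OF J(1), of \<delta>] elim by simp
  qed
  have lower: "\<forall>\<^sub>F \<delta> in at_right 0. 1 - \<kappa> \<le> ?m \<delta> / \<delta>" if "\<kappa> > 0" for \<kappa>
    using small meas K(2)[OF that] eventually_one_sided_subset[OF x J(1)]
  proof eventually_elim
    case (elim \<delta>)
    let ?A = "{y \<in> I \<inter> J \<delta>. P y}" and ?B = "{x-\<delta><..<x+\<delta>} - K"
    have sub: "J \<delta> \<subseteq> ?A \<union> ?B"
    proof
      fix y assume y: "y \<in> J \<delta>"
      then have "y \<in> {x-\<delta><..<x+\<delta>}" "y \<noteq> x"
        using one_sided_subset[OF J(1), of \<delta>] by auto
      then have "dist y x < d"
        using elim by (auto simp: dist_real_def)
      then show "y \<in> ?A \<union> ?B"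
        using d(2)[of y] y J(2)[of \<delta>] elim \<open>y \<noteq> x\<close> \<open>y \<in> {x-\<delta><..<x+\<delta>}\<close> by blast
    qed
    have fin: "?A \<in> fmeasurable lborel" "?B \<in> fmeasurable lborel"
    proof -
      show "?A \<in> fmeasurable lborel"
        using elim by (intro fmeasurableI2[OF one_sided_fmeasurable[OF J(1), of \<delta>]]) auto
      show "?B \<in> fmeasurable lborel"
        using K(1) by (intro bounded_fmeasurable_lborel bounded_subset[OF bounded_ball[of x \<delta>]])
          (auto simp: dist_real_def)
    qed
    have "\<delta> = measure lborel (J \<delta>)"
      using one_sided_measure[OF J(1)] elim by simp
    also have "\<dots> \<le> measure lborel (?A \<union> ?B)"
      using sub fin one_sided_open[OF J(1)] by (intro measure_mono_fmeasurable) auto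
    also have "\<dots> \<le> measure lborel ?A + measure lborel ?B"
      using fin by (intro measure_Un_le) auto
    finally show ?case
      using elim by (simp add: field_simps)
  qed
  show ?thesis
    unfolding full_density_def
  proof (rule order_tendstoI)
    fix a :: real assume "a < 1"
    then show "\<forall>\<^sub>F \<delta> in at_right 0. a < ?m \<delta> / \<delta>"
      using lower[of "(1 - a) / 2"] by (auto elim!: eventually_mono simp: field_simps)
  next
    fix a :: real assume "1 < a"
    then show "\<forall>\<^sub>F \<delta> in at_right 0. ?m \<delta> / \<delta> < a"
      using upper by (auto elim!: eventually_mono)
  qed
qed

lemma full_density_of_eventually:
  assumes "x \<in> interior I" "one_sided x J" "\<And>\<delta>. J \<delta> \<subseteq> S"
    and "\<forall>\<^sub>F \<delta> in at_right 0. {y \<in> I \<inter> J \<delta>. P y} \<in> sets borel"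
    and "\<forall>\<^sub>F y in at x within I \<inter> S. P y"
  shows "full_density I J P"
proof (rule full_density_of_dense_subset[OF assms(1-4), of UNIV])
  show "\<forall>\<^sub>F \<delta> in at_right 0. measure lborel ({x-\<delta><..<x+\<delta>} - UNIV) \<le> \<kappa> * \<delta>" if "\<kappa> > 0" for \<kappa>
    using eventually_at_right_less[of "0::real"] that by (auto elim!: eventually_mono)
qed (use assms(5) in auto)

text \<open>For \<open>s < t\<close> the two sets would be disjoint in a window of length
  \<open>\<delta>\<close>, yet their densities would add up to 2 in the limit. This is the
  inequality between lower and upper approximate derivates.\<close>

lemma full_density_le_ge:
  fixes f :: "real \<Rightarrow> real"
  assumes f: "continuous_on I f" and x: "x \<in> interior I" and J: "one_sided x J"
    and "full_density I J (\<lambda>y. (f y - f x) / (y - x) \<ge> t)" "full_density I J (\<lambda>y. (f y - f x) / (y - x) \<le> s)"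
  shows "t \<le> s"
proof (rule ccontr)
  assume "\<not> t \<le> s"
  let ?A = "\<lambda>\<delta>. {y \<in> I \<inter> J \<delta>. (f y - f x) / (y - x) \<ge> t}"
  let ?B = "\<lambda>\<delta>. {y \<in> I \<inter> J \<delta>. (f y - f x) / (y - x) \<le> s}"
  have lim: "((\<lambda>\<delta>. measure lborel (?A \<delta>) / \<delta> + measure lborel (?B \<delta>) / \<delta>) \<longlongrightarrow> 1 + 1) (at_right 0)"
    using assms(4,5) unfolding full_density_def by (rule tendsto_add)
  have "\<forall>\<^sub>F \<delta> in at_right (0::real). 0 < \<delta>"
    by (rule eventually_at_right_less)
  with eventually_sets_quotient(2)[OF f x J, of t] eventually_sets_quotient(1)[OF f x J, of s]
  have "\<forall>\<^sub>F \<delta> in at_right 0. measure lborel (?A \<delta>) / \<delta> + measure lborel (?B \<delta>) / \<delta> \<le> 1"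
  proof eventually_elim
    case (elim \<delta>)
    have fin: "?A \<delta> \<in> fmeasurable lborel" "?B \<delta> \<in> fmeasurable lborel"
      using elim by (auto intro!: fmeasurableI2[OF one_sided_fmeasurable[OF J, of \<delta>]])
    have "measure lborel (?A \<delta>) + measure lborel (?B \<delta>) = measure lborel (?A \<delta> \<union> ?B \<delta>)"
      using fin \<open>\<not> t \<le> s\<close> by (intro measure_Union[symmetric]) (auto simp: fmeasurable_def)
    also have "\<dots> \<le> measure lborel (J \<delta>)"
      using fmeasurableD[OF fin(1)] fmeasurableD[OF fin(2)]
      by (intro measure_mono_fmeasurable one_sided_fmeasurable[OF J] sets.Un) auto
    also have "\<dots> = \<delta>"
      using one_sided_measure[OF J] elim by simp
    finally show ?case
      using elim by (simp add: field_simps)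
  qed
  then have "1 + 1 \<le> (1 :: real)"
    using lim by (intro tendsto_upperbound[OF lim]) auto
  then show False
    by simp
qed

text \<open>A squeeze: the definition gives \<open>?U \<le> L\<close> and \<open>L \<le> ?V\<close>,
  and \<open>full_density_le_ge\<close> gives \<open>?V \<le> ?U\<close>.\<close>

lemma has_ap_deriv_Dini:
  assumes f: "continuous_on I f" and x: "x \<in> interior I" and J: "one_sided x J" and L: "has_ap_deriv f I x L"
  shows "Inf {ereal t | t. full_density I J (\<lambda>y. (f y - f x) / (y - x) \<le> t)} = L" (is "?U = L")
    and "Sup {ereal t | t. full_density I J (\<lambda>y. (f y - f x) / (y - x) \<ge> t)} = L" (is "?V = L")
proof -
  have "?U \<le> L"
  proof (rule ccontr)
    assume "\<not> ?U \<le> L"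
    then have "L < ?U"
      by simp
    from ereal_dense2[OF this] obtain t where t: "L < ereal t" "ereal t < ?U"
      by (elim exE conjE)
    then have "full_density I J (\<lambda>y. (f y - f x) / (y - x) \<le> t)"
      using L J by (simp add: has_ap_deriv_def)
    then have "?U \<le> ereal t"
      by (intro Inf_lower) blast
    with t show False by simp
  qed
  moreover have "L \<le> ?V"
  proof (rule ccontr)
    assume "\<not> L \<le> ?V"
    then have "?V < L"
      by simp
    from ereal_dense2[OF this] obtain t where t: "?V < ereal t" "ereal t < L"
      by (elim exE conjE)
    then have "full_density I J (\<lambda>y. (f y - f x) / (y - x) \<ge> t)"
      using L J by (simp add: has_ap_deriv_def)
    then have "ereal t \<le> ?V"
      by (intro Sup_upper) blast
    with t show False by simp
  qed
  moreover have "?V \<le> ?U"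
    using full_density_le_ge[OF f x J] by (intro Sup_least Inf_greatest) auto
  ultimately show "?U = L" "?V = L"
    by auto
qed

lemma has_ap_deriv_D_ap:
  assumes "continuous_on I f" "x \<in> interior I" "has_ap_deriv f I x L"
  shows "x \<in> D_ap f I"
  using has_ap_deriv_Dini[OF assms(1,2) one_sided_right assms(3)]
    has_ap_deriv_Dini[OF assms(1,2) one_sided_left assms(3)] assms(2) interior_subset
  unfolding D_ap_def ap_Dini_full_density by auto

lemma has_ap_deriv_uminus:
  assumes "has_ap_deriv (\<lambda>x. - f x) I x L"
  shows "has_ap_deriv f I x (- L)"
proof -
  have q: "(- f y - - f x) / (y - x) = - ((f y - f x) / (y - x))" for y
    by (simp add: divide_simps)
  show ?thesis
    unfolding has_ap_deriv_def
  proof (intro allI impI conjI)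
    fix J t assume J: "one_sided x J" and t: "- L < ereal t"
    have "ereal (- t) < L"
      using t by (metis ereal_minus_less_minus ereal_uminus_uminus uminus_ereal.simps(1))
    then have "full_density I J (\<lambda>y. - t \<le> (- f y - - f x) / (y - x))"
      using assms J unfolding has_ap_deriv_def by blast
    then show "full_density I J (\<lambda>y. (f y - f x) / (y - x) \<le> t)"
      unfolding q by simp
  next
    fix J t assume J: "one_sided x J" and t: "ereal t < - L"
    have "L < ereal (- t)"
      using t by (metis ereal_minus_less_minus ereal_uminus_uminus uminus_ereal.simps(1))
    then have "full_density I J (\<lambda>y. (- f y - - f x) / (y - x) \<le> - t)"
      using assms J unfolding has_ap_deriv_def by blast
    then show "full_density I J (\<lambda>y. t \<le> (f y - f x) / (y - x))"
      unfolding q by simp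
  qed
qed

lemma has_ap_deriv_MInf:
  fixes f :: "real \<Rightarrow> real"
  assumes f: "continuous_on I f" and x: "x \<in> interior I"
    and "\<And>t. \<forall>\<^sub>F y in at x. (f y - f x) / (y - x) \<le> t"
  shows "has_ap_deriv f I x (-\<infinity>)"
  unfolding has_ap_deriv_def
proof (intro allI impI conjI)
  fix J t assume J: "one_sided x J"
  show "full_density I J (\<lambda>y. (f y - f x) / (y - x) \<le> t)"
    using eventually_sets_quotient(1)[OF f x J] filter_leD[OF at_le assms(3)]
    by (intro full_density_of_eventually[OF x J, of UNIV]) auto
qed auto

lemma has_ap_deriv_relative:
  fixes f :: "real \<Rightarrow> real"
  assumes f: "continuous_on I f" and x: "x \<in> interior I"
    and K: "K \<in> sets borel" "\<And>\<kappa>. \<kappa> > 0 \<Longrightarrow> \<forall>\<^sub>F \<delta> in at_right 0. measure lborel ({x-\<delta><..<x+\<delta>} - K) \<le> \<kappa> * \<delta>"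
    and D: "((\<lambda>y. (f y - f x) / (y - x)) \<longlongrightarrow> D) (at x within K)"
  shows "has_ap_deriv f I x (ereal D)"
  unfolding has_ap_deriv_def
proof (intro allI impI conjI)
  fix J t assume J: "one_sided x J"
  have *: "\<forall>\<^sub>F y in at x within I \<inter> UNIV. y \<in> K \<longrightarrow> P y" if "\<forall>\<^sub>F y in at x within K. P y" for P
    using that unfolding eventually_at_filter by (auto elim: eventually_mono)
  { assume "ereal D < ereal t"
    then have "\<forall>\<^sub>F y in at x within K. (f y - f x) / (y - x) \<le> t"
      using order_tendstoD(2)[OF D, of t] by (auto elim: eventually_mono)
    then show "full_density I J (\<lambda>y. (f y - f x) / (y - x) \<le> t)"
      by (intro full_density_of_dense_subset[OF x J, of UNIV _ K] * K eventually_sets_quotient[OF f x J]) auto }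
  { assume "ereal t < ereal D"
    then have "\<forall>\<^sub>F y in at x within K. (f y - f x) / (y - x) \<ge> t"
      using order_tendstoD(1)[OF D, of t] by (auto elim: eventually_mono)
    then show "full_density I J (\<lambda>y. (f y - f x) / (y - x) \<ge> t)"
      by (intro full_density_of_dense_subset[OF x J, of UNIV _ K] * K eventually_sets_quotient[OF f x J]) auto }
qed

text \<open>The near half of the window accounts for density 1/2 only. A point at distance
  comparable to \<open>\<delta>\<close> is all that is kept of the density condition when cones are
  formed.\<close>

lemma full_density_imp_far_points:
  assumes J: "one_sided x J" and "full_density I J P"
  obtains \<eta> where "\<eta> > 0" "\<And>\<delta>. \<lbrakk>0 < \<delta>; \<delta> < \<eta>\<rbrakk> \<Longrightarrow> \<exists>y \<in> I \<inter> J \<delta>. P y \<and> \<bar>y - x\<bar> > \<delta> / 2"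
proof -
  have "\<forall>\<^sub>F \<delta> in at_right 0. 1 / 2 < measure lborel {y \<in> I \<inter> J \<delta>. P y} / \<delta>"
    using assms(2) unfolding full_density_def by (rule order_tendstoD) simp
  then obtain \<eta> where \<eta>: "\<eta> > 0" "\<And>\<delta>. \<lbrakk>0 < \<delta>; \<delta> < \<eta>\<rbrakk> \<Longrightarrow> 1 / 2 < measure lborel {y \<in> I \<inter> J \<delta>. P y} / \<delta>"
    unfolding eventually_at_right_field by auto
  have "\<exists>y \<in> I \<inter> J \<delta>. P y \<and> \<bar>y - x\<bar> > \<delta> / 2" if \<delta>: "0 < \<delta>" "\<delta> < \<eta>" for \<delta>
  proof (rule ccontr)
    assume neg: "\<not> ?thesis"
    let ?A = "{y \<in> I \<inter> J \<delta>. P y}"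
    define B where "B = J \<delta> \<inter> {x - \<delta> / 2..x + \<delta> / 2}"
    have "B = {x<..x + \<delta> / 2} \<or> B = {x - \<delta> / 2..<x}"
      using J \<delta> unfolding one_sided_def B_def by auto
    then have B: "B \<in> fmeasurable lborel" "measure lborel B = \<delta> / 2"
      using \<delta> by (auto intro!: bounded_fmeasurable_lborel)
    have "?A \<subseteq> B"
    proof
      fix y assume y: "y \<in> ?A"
      then have "\<bar>y - x\<bar> \<le> \<delta> / 2"
        using neg by force
      then show "y \<in> B"
        using y unfolding B_def abs_le_iff by auto
    qed
    \<comment> \<open>If \<open>?A\<close> is not measurable, its \<open>measure\<close> is 0 by
      convention, so the bound holds in that case too.\<close>
    have "measure lborel ?A \<le> \<delta> / 2"
    proof (cases "?A \<in> sets lborel")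
      case True
      then show ?thesis
        using measure_mono_fmeasurable[OF \<open>?A \<subseteq> B\<close> _ B(1)] B(2) by simp
    next
      case False
      then show ?thesis
        using \<delta> by (simp add: measure_notin_sets)
    qed
    with \<eta>(2)[OF \<delta>] \<delta> show False
      by (simp add: field_simps)
  qed
  with \<eta>(1) show thesis
    using that by blast
qed

text \<open>An ordinary bound on the quotients near \<open>x\<close> on the side \<open>S\<close>
  holds throughout small windows, hence with full density, and so bounds the approximate derivate as
  well.\<close>

lemma Dini_upper_eq_PInf:
  fixes f :: "real \<Rightarrow> real"
  assumes f: "continuous_on I f" and x: "x \<in> interior I" and J: "one_sided x J" "\<And>\<delta>. J \<delta> \<subseteq> S"
    and "Inf {ereal t | t. full_density I J (\<lambda>y. (f y - f x) / (y - x) \<le> t)} = \<infinity>"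
  shows "Limsup (at x within I \<inter> S) (\<lambda>y. ereal ((f y - f x) / (y - x))) = \<infinity>"
proof (rule ccontr)
  let ?L = "Limsup (at x within I \<inter> S) (\<lambda>y. ereal ((f y - f x) / (y - x)))"
  assume "?L \<noteq> \<infinity>"
  then obtain t where "?L < ereal t"
    using less_PInf_Ex_of_nat by fastforce
  then have "\<forall>\<^sub>F y in at x within I \<inter> S. ereal ((f y - f x) / (y - x)) < ereal t"
    by (rule Limsup_lessD)
  then have "\<forall>\<^sub>F y in at x within I \<inter> S. (f y - f x) / (y - x) \<le> t"
    by (auto elim: eventually_mono)
  then have "full_density I J (\<lambda>y. (f y - f x) / (y - x) \<le> t)"
    using eventually_sets_quotient[OF f x J(1)] by (intro full_density_of_eventually[OF x J]) auto
  then have "Inf {ereal t | t. full_density I J (\<lambda>y. (f y - f x) / (y - x) \<le> t)} \<le> ereal t"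
    by (intro Inf_lower) blast
  then show False
    using assms(5) by simp
qed

lemma Dini_lower_eq_MInf:
  fixes f :: "real \<Rightarrow> real"
  assumes f: "continuous_on I f" and x: "x \<in> interior I" and J: "one_sided x J" "\<And>\<delta>. J \<delta> \<subseteq> S"
    and "Sup {ereal t | t. full_density I J (\<lambda>y. (f y - f x) / (y - x) \<ge> t)} = -\<infinity>"
  shows "Liminf (at x within I \<inter> S) (\<lambda>y. ereal ((f y - f x) / (y - x))) = -\<infinity>"
proof (rule ccontr)
  let ?L = "Liminf (at x within I \<inter> S) (\<lambda>y. ereal ((f y - f x) / (y - x)))"
  assume "?L \<noteq> -\<infinity>"
  then obtain t where "ereal t < ?L"
    using ereal_dense2[of "-\<infinity>" ?L] by auto
  then have "\<forall>\<^sub>F y in at x within I \<inter> S. ereal t < ereal ((f y - f x) / (y - x))"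
    by (rule less_LiminfD)
  then have "\<forall>\<^sub>F y in at x within I \<inter> S. (f y - f x) / (y - x) \<ge> t"
    by (auto elim: eventually_mono)
  then have "full_density I J (\<lambda>y. (f y - f x) / (y - x) \<ge> t)"
    using eventually_sets_quotient[OF f x J(1)] by (intro full_density_of_eventually[OF x J]) auto
  then have "ereal t \<le> Sup {ereal t | t. full_density I J (\<lambda>y. (f y - f x) / (y - x) \<ge> t)}"
    by (intro Sup_upper) blast
  then show False
    using assms(5) by simp
qed

lemma K_ap_imp_knot_point:
  assumes "continuous_on I f" "x \<in> interior I" "x \<in> K_ap f I"
  shows "knot_point f I x"
proof -
  have "\<And>\<delta>. {x<..<x+\<delta>} \<subseteq> {x<..}" "\<And>\<delta>. {x-\<delta><..<x} \<subseteq> {..<x}"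
    by auto
  note sides = one_sided_right this(1) one_sided_left this(2)
  show ?thesis
    using assms(3)
      Dini_upper_eq_PInf[OF assms(1,2) sides(1,2)] Dini_upper_eq_PInf[OF assms(1,2) sides(3,4)]
      Dini_lower_eq_MInf[OF assms(1,2) sides(1,2)] Dini_lower_eq_MInf[OF assms(1,2) sides(3,4)]
    unfolding knot_point_def K_ap_def ap_Dini_full_density
      dini_upper_right_def dini_lower_right_def dini_upper_left_def dini_lower_left_def
    by blast
qed

section \<open>Consequences of the M-condition\<close>

lemma dist_graph_pt_ge: "\<bar>x - y\<bar> \<le> dist (graph_pt f x) (graph_pt f y)"
  "\<bar>f x - f y\<bar> \<le> dist (graph_pt f x) (graph_pt f y)"
  using dist_fst_le[of "graph_pt f x" "graph_pt f y"] dist_snd_le[of "graph_pt f x" "graph_pt f y"]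
  by (simp_all add: graph_pt_def dist_real_def)

lemma dist_graph_pt_le: "dist (graph_pt f x) (graph_pt f y) \<le> \<bar>x - y\<bar> + \<bar>f x - f y\<bar>"
  unfolding graph_pt_def dist_Pair_Pair dist_real_def
  using sqrt_sum_squares_le_sum_abs[of "\<bar>x - y\<bar>" "\<bar>f x - f y\<bar>"] by simp

text \<open>The point reflection of the graph keeps every chord slope and swaps left and right, so
  left-hand statements are right-hand ones for the reflected function.\<close>

lemma dist_graph_pt_point_reflection:
  "dist (graph_pt (\<lambda>x. - f (- x)) x) (graph_pt (\<lambda>x. - f (- x)) y) = dist (graph_pt f (- x)) (graph_pt f (- y))"
  unfolding graph_pt_def dist_Pair_Pair dist_real_def by (simp add: abs_minus_commute)

lemma dist_graph_pt_uminus: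
  "dist (graph_pt (\<lambda>x. - f x) x) (graph_pt (\<lambda>x. - f x) y) = dist (graph_pt f x) (graph_pt f y)"
  unfolding graph_pt_def dist_Pair_Pair dist_real_def by (simp add: abs_minus_commute)

text \<open>If the chord slope at \<open>y\<close> were too steep, the graph of \<open>f - n id\<close> would return to its level at \<open>y\<close> beyond \<open>y'\<close>,
  at a point far closer to \<open>y\<close> than \<open>y'\<close> is.\<close>
lemma cone_growth_right:
  fixes f :: "real \<Rightarrow> real"
  assumes "y < y'" "y' < z" "z - y \<le> 2 * (y' - y)" "n \<ge> 1" "continuous_on {y'..z} f"
    and z: "f z - f y \<le> n * (z - y)"
    and M: "\<And>w. \<lbrakk>y' < w; w \<le> z\<rbrakk> \<Longrightarrow> dist (graph_pt f y) (graph_pt f y') \<le> n * dist (graph_pt f y) (graph_pt f w)"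
  shows "f y' - f y \<le> 2 * n * (1 + n) * (y' - y)"
proof (cases "f y' - f y \<le> n * (y' - y)")
  case True
  have "n * (y' - y) \<le> 2 * n * (1 + n) * (y' - y)"
    using assms(1,4) by (intro mult_right_mono) auto
  with True show ?thesis by linarith
next
  case False
  define g where "g w = f w - n * w" for w
  have "g z \<le> g y" "g y \<le> g y'"
    using z False by (auto simp: g_def algebra_simps)
  moreover have "continuous_on {y'..z} g"
    unfolding g_def by (intro continuous_intros assms(5))
  ultimately obtain w where w: "y' \<le> w" "w \<le> z" "g w = g y"
    using IVT2'[of g z "g y" y'] assms(2) by auto
  have "w \<noteq> y'"
    using w(3) False by (auto simp: g_def algebra_simps)
  then have "dist (graph_pt f y) (graph_pt f y') \<le> n * dist (graph_pt f y) (graph_pt f w)"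
    using M w by simp
  \<comment> \<open>Origin of the constant: on the line of slope \<open>n\<close> through the point
    over \<open>y\<close> the distance is at most \<open>(1 + n) * (w - y)\<close>, the M-condition
    costs a factor \<open>n\<close>, and \<open>w\<close> is at most twice as far from
    \<open>y\<close> as \<open>y'\<close> is.\<close>
  also have "\<dots> \<le> n * (\<bar>y - w\<bar> + \<bar>f y - f w\<bar>)"
    using assms(4) by (intro mult_left_mono dist_graph_pt_le) auto
  also have "f y - f w = n * (y - w)"
    using w(3) by (simp add: g_def algebra_simps)
  also have "\<bar>n * (y - w)\<bar> = n * (w - y)"
    using assms w by (simp add: abs_mult)
  also have "n * (\<bar>y - w\<bar> + n * (w - y)) = n * (1 + n) * (w - y)"
    using assms w by (simp add: algebra_simps)
  also have "\<dots> \<le> n * (1 + n) * (2 * (y' - y))"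
    using assms w by (intro mult_left_mono) auto
  finally show ?thesis
    using dist_graph_pt_ge(2)[of f y y'] by (simp add: algebra_simps)
qed

lemma cone_growth_left:
  fixes f :: "real \<Rightarrow> real"
  assumes "x < y'" "y' < y" "y - x \<le> 2 * (y - y')" "n \<ge> 1" "continuous_on {x..y'} f"
    and x: "f y - f x \<le> n * (y - x)"
    and M: "\<And>w. \<lbrakk>x \<le> w; w < y'\<rbrakk> \<Longrightarrow> dist (graph_pt f y) (graph_pt f y') \<le> n * dist (graph_pt f y) (graph_pt f w)"
  shows "f y - f y' \<le> 2 * n * (1 + n) * (y - y')"
proof -
  let ?F = "\<lambda>x. - f (- x)"
  have "continuous_on {- y'..- x} ?F"
    by (intro continuous_intros continuous_on_compose2[OF assms(5)]) auto
  then have "?F (- y') - ?F (- y) \<le> 2 * n * (1 + n) * (- y' - (- y))"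
    using assms by (intro cone_growth_right[of "- y" "- y'" "- x"])
      (auto simp: dist_graph_pt_point_reflection)
  then show ?thesis
    by simp
qed

text \<open>Here \<open>\<phi> x = (C + 1) x - f x\<close>. The hypotheses \<open>flat\<close> and \<open>dense\<close> say that \<open>\<phi>\<inverse>\<close> has derivative \<open>0\<close> and
  that \<open>\<phi> ` K\<close> has no large gaps to the right of \<open>\<phi> x0\<close>. Were \<open>f z\<close> not far below \<open>f x0\<close>, the graph would revisit over \<open>(k, z]\<close>
  the height \<open>f w\<close> of a point \<open>w < k\<close> of \<open>K\<close>, which the M-condition at \<open>k\<close> forbids.\<close>
lemma vertical_right:
  fixes f :: "real \<Rightarrow> real"
  assumes cont: "continuous_on {a..b} f" and K: "compact K" "K \<subseteq> {a..b}" "x0 \<in> K" and c: "c \<ge> 1" and C: "C \<ge> 0"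
    and M: "\<And>x y z. \<lbrakk>y \<in> K; a \<le> x; x < y; y < z; z \<le> b\<rbrakk> \<Longrightarrow>
      dist (graph_pt f x) (graph_pt f y) \<le> c * dist (graph_pt f x) (graph_pt f z)"
    and \<phi>: "\<And>x. \<phi> x = (C + 1) * x - f x"
    and growth: "\<And>x y. \<lbrakk>x \<in> K; y \<in> K; x \<le> y\<rbrakk> \<Longrightarrow> y - x \<le> \<phi> y - \<phi> x"
    and flat: "\<And>\<kappa>. \<kappa> > 0 \<Longrightarrow> \<exists>\<eta>>0. \<forall>x\<in>K. x0 < x \<and> \<phi> x - \<phi> x0 < \<eta> \<longrightarrow> x - x0 \<le> \<kappa> * (\<phi> x - \<phi> x0)"
    and dense: "\<And>\<kappa>. \<kappa> > 0 \<Longrightarrow> \<exists>\<eta>>0. \<forall>r. 0 < r \<and> r < \<eta> \<longrightarrow>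
      (\<exists>k\<in>K. \<phi> x0 + (1 - \<kappa>) * r \<le> \<phi> k \<and> \<phi> k \<le> \<phi> x0 + r)"
    and T: "T \<ge> 0"
  shows "\<exists>\<eta>>0. \<forall>z. x0 < z \<and> z < x0 + \<eta> \<longrightarrow> (f z - f x0) / (z - x0) \<le> - T"
proof -
  \<comment> \<open>The horizontal errors \<open>(C + 1) * \<kappa> * r + c * \<kappa> * r\<close>
    and \<open>T * \<kappa> * r\<close> are thereby each at most \<open>r / 16\<close>, to be
    compared with vertical drops of size \<open>r / 8\<close>.\<close>
  define \<kappa> where "\<kappa> = 1 / (16 * (C + 1 + c + T))"
  have \<kappa>: "\<kappa> > 0"
    using c C T by (simp add: \<kappa>_def)
  have \<kappa>_eq: "16 * (C + 1 + c + T) * \<kappa> = 1"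
    using c C T by (simp add: \<kappa>_def)
  obtain e1 where e1: "e1 > 0" "\<And>x. \<lbrakk>x \<in> K; x0 < x; \<phi> x - \<phi> x0 < e1\<rbrakk> \<Longrightarrow> x - x0 \<le> \<kappa> * (\<phi> x - \<phi> x0)"
    using flat[OF \<kappa>] by blast
  obtain e2 where e2: "e2 > 0" "\<And>r. \<lbrakk>0 < r; r < e2\<rbrakk> \<Longrightarrow>
      \<exists>k\<in>K. \<phi> x0 + 5 / 6 * r \<le> \<phi> k \<and> \<phi> k \<le> \<phi> x0 + r"
    using dense[of "1 / 6"] by auto
  define r0 where "r0 = min e1 e2 / 2"
  have r0: "0 < r0" "r0 < e1" "r0 < e2"
    using e1(1) e2(1) by (auto simp: r0_def)
  have less: "x < y" if "x \<in> K" "y \<in> K" "\<phi> x < \<phi> y" for x y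
    using growth[of y x] that by force
  obtain k0 where k0: "k0 \<in> K" "\<phi> x0 + 5 / 6 * r0 \<le> \<phi> k0" "\<phi> k0 \<le> \<phi> x0 + r0"
    using e2(2)[of r0] r0 by blast
  have "x0 < k0"
    using less[OF K(3) k0(1)] k0(2) r0(1) by simp
  have "(f z - f x0) / (z - x0) \<le> - T" if z: "x0 < z" "z < k0" for z
  proof -
    \<comment> \<open>\<open>z\<close> may lie in a gap of \<open>K\<close>, so the scale
      \<open>r\<close> is read off at the next point \<open>x2\<close> of \<open>K\<close>. Any
      point of \<open>K\<close> to the left of \<open>x2\<close> is also to the left of
      \<open>z\<close>.\<close>
    have "compact (K \<inter> {z..})" "K \<inter> {z..} \<noteq> {}"
      using K(1) k0(1) z by (auto intro: compact_Int_closed)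
    then obtain x2 where x2: "x2 \<in> K" "z \<le> x2" "\<And>k. \<lbrakk>k \<in> K; z \<le> k\<rbrakk> \<Longrightarrow> x2 \<le> k"
      using compact_attains_inf[of "K \<inter> {z..}"] by auto
    define r where "r = \<phi> x2 - \<phi> x0"
    have "x2 - x0 \<le> r"
      using growth[OF K(3) x2(1)] x2(2) z by (simp add: r_def)
    then have "r > 0"
      using x2(2) z by simp
    have "x2 \<le> k0"
      using x2(3) k0(1) z by simp
    then have "\<phi> x2 \<le> \<phi> k0"
      using growth[OF x2(1) k0(1)] by simp
    then have "r \<le> r0"
      using k0(3) by (simp add: r_def)
    have near: "k - x0 \<le> \<kappa> * r" if "k \<in> K" "x0 < k" "k \<le> x2" for k
    proof -
      have "\<phi> k - \<phi> x0 \<le> r"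
        using growth[OF that(1) x2(1) that(3)] that(3) by (simp add: r_def)
      then have "k - x0 \<le> \<kappa> * (\<phi> k - \<phi> x0)"
        using e1(2)[OF that(1,2)] \<open>r \<le> r0\<close> r0 by simp
      also have "\<dots> \<le> \<kappa> * r"
        using \<kappa> \<open>\<phi> k - \<phi> x0 \<le> r\<close> by (intro mult_left_mono) auto
      finally show ?thesis .
    qed
    \<comment> \<open>With density parameter 1/6, the bands ending at \<open>r / 2\<close> and
      \<open>3 / 4 * r\<close> are separated by \<open>r / 8\<close>. This fixes the order
      \<open>w < k < x2\<close> and makes \<open>f\<close> drop by almost \<open>r / 8\<close> from
      \<open>w\<close> to \<open>k\<close>.\<close>
    obtain w where w: "w \<in> K" "\<phi> x0 + 5 / 12 * r \<le> \<phi> w" "\<phi> w \<le> \<phi> x0 + r / 2"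
      using e2(2)[of "r / 2"] \<open>r > 0\<close> \<open>r \<le> r0\<close> r0 by auto
    obtain k where k: "k \<in> K" "\<phi> x0 + 5 / 8 * r \<le> \<phi> k" "\<phi> k \<le> \<phi> x0 + 3 / 4 * r"
      using e2(2)[of "3 / 4 * r"] \<open>r > 0\<close> \<open>r \<le> r0\<close> r0 by auto
    have "\<phi> x0 < \<phi> w" "\<phi> w < \<phi> k" "\<phi> k < \<phi> x2"
      using w k \<open>r > 0\<close> r_def by linarith+
    then have order: "x0 < w" "w < k" "k < x2"
      using less K(3) w(1) k(1) x2(1) by blast+
    have "k < z"
      using x2(3)[OF k(1)] order by linarith
    have f_eq: "f x = (C + 1) * x - \<phi> x" for x
      by (simp add: \<phi>)
    have x2_near: "x2 - x0 \<le> \<kappa> * r"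
      using near[OF x2(1)] order by simp
    have Cb: "(C + 1) * (x2 - x0) \<le> (C + 1) * \<kappa> * r"
      using x2_near C by (simp add: mult.assoc mult_left_mono)
    have "f z < f w"
    proof (rule ccontr)
      assume "\<not> f z < f w"
      have fwk: "f w - f k \<ge> r / 8 - (C + 1) * \<kappa> * r"
      proof -
        have "(C + 1) * (k - w) \<le> (C + 1) * (x2 - x0)"
          using order C by (intro mult_left_mono) auto
        moreover have "f w - f k = (\<phi> k - \<phi> w) - (C + 1) * (k - w)"
          unfolding f_eq by (simp add: algebra_simps)
        ultimately show ?thesis
          using w(3) k(2) Cb by simp
      qed
      have small: "(C + 1) * \<kappa> * r + c * \<kappa> * r < r / 8"
      proof -
        have "16 * ((C + 1 + c) * \<kappa>) \<le> 1"
          using \<kappa>_eq mult_nonneg_nonneg[OF T, of \<kappa>] \<kappa> by (simp add: algebra_simps)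
        then have "16 * ((C + 1 + c) * \<kappa>) * r \<le> 1 * r"
          using \<open>r > 0\<close> by (intro mult_right_mono) auto
        then show ?thesis
          using \<open>r > 0\<close> by (simp add: algebra_simps)
      qed
      moreover have ck: "0 \<le> c * \<kappa> * r"
        using c \<kappa> \<open>r > 0\<close> by simp
      ultimately have "f k < f w"
        using fwk by linarith
      moreover have "continuous_on {k..z} f"
        using K(2) k(1) x2(1,2) by (intro continuous_on_subset[OF cont]) auto
      ultimately obtain z' where z': "k \<le> z'" "z' \<le> z" "f z' = f w"
        using IVT'[of f k "f w" z] \<open>k < z\<close> \<open>\<not> f z < f w\<close> by auto
      have "k < z'"
        using z' \<open>f k < f w\<close> by (cases "k = z'") auto
      \<comment> \<open>Since \<open>z'\<close> has the height of \<open>w\<close>, their distance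
        is purely horizontal and at most \<open>\<kappa> * r\<close>; the M-condition at
        \<open>k\<close> then makes the drop from \<open>w\<close> to \<open>k\<close> too
        small.\<close>
      have "f w - f k \<le> dist (graph_pt f w) (graph_pt f k)"
        using dist_graph_pt_ge(2)[of f w k] by simp
      also have "\<dots> \<le> c * dist (graph_pt f w) (graph_pt f z')"
        using K(2) w(1) x2 z' \<open>k < z'\<close> order by (intro M[OF k(1)]) auto
      also have "\<dots> \<le> c * (\<bar>w - z'\<bar> + \<bar>f w - f z'\<bar>)"
        using c by (intro mult_left_mono dist_graph_pt_le) auto
      also have "\<dots> \<le> c * (x2 - x0)"
        using z' \<open>k < z'\<close> order x2 c by (intro mult_left_mono) auto
      also have "\<dots> \<le> c * (\<kappa> * r)"
        using x2_near c by (intro mult_left_mono) auto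
      finally show False
        using small fwk by (simp add: mult.assoc)
    qed
    moreover have "f w - f x0 \<le> - r / 8"
    proof -
      have "(C + 1) * (w - x0) \<le> (C + 1) * (x2 - x0)"
        using order C by (intro mult_left_mono) auto
      moreover have "16 * ((C + 1) * \<kappa>) * r \<le> 1 * r"
      proof (rule mult_right_mono)
        have "0 \<le> (c + T) * \<kappa>"
          using c T \<kappa> by simp
        then show "16 * ((C + 1) * \<kappa>) \<le> 1"
          using \<kappa>_eq by (simp add: algebra_simps)
      qed (use \<open>r > 0\<close> in simp)
      moreover have "f w - f x0 = (C + 1) * (w - x0) - (\<phi> w - \<phi> x0)"
        unfolding f_eq by (simp add: algebra_simps)
      ultimately show ?thesis
        using w(2) Cb \<open>r > 0\<close> by (simp only: mult.assoc)
    qed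
    moreover have "T * (z - x0) \<le> r / 8"
    proof -
      have "T * (z - x0) \<le> T * (\<kappa> * r)"
        using x2_near x2(2) T by (intro mult_left_mono) auto
      moreover have "16 * (T * \<kappa>) * r \<le> 1 * r"
      proof (rule mult_right_mono)
        have "0 \<le> (C + 1 + c) * \<kappa>"
          using c C \<kappa> by simp
        then show "16 * (T * \<kappa>) \<le> 1"
          using \<kappa>_eq by (simp add: algebra_simps)
      qed (use \<open>r > 0\<close> in simp)
      ultimately show ?thesis
        using \<open>r > 0\<close> by (simp only: mult.assoc)
    qed
    ultimately have "f z - f x0 \<le> - T * (z - x0)"
      by simp
    then show ?thesis
      using z by (simp add: pos_divide_le_eq)
  qed
  then show ?thesis
    using \<open>x0 < k0\<close> by (intro exI[of _ "k0 - x0"]) auto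
qed

text \<open>A monotone 1-Lipschitz map sends each interval of a cover into one of at most the same
  length. This will bound the part of a neighbourhood of \<open>x\<close> missed by \<open>K\<close>
  through the parameters missed by the image of \<open>K\<close> under
  \<open>\<phi>\<close>.\<close>

lemma emeasure_subset_mono_lipschitz_image:
  fixes X :: "real \<Rightarrow> real"
  assumes X: "mono X" "1-lipschitz_on UNIV X"
    and W: "bounded W" "W \<in> sets lebesgue" "emeasure lebesgue W < ennreal e" and A: "A \<subseteq> X ` W"
  shows "emeasure lborel A \<le> ennreal e"
proof -
  obtain a b :: "nat \<Rightarrow> real" where ab: "\<And>i. a i \<le> b i" "W \<subseteq> (\<Union>i. {a i..b i})"
    "(\<Sum>i. ennreal (b i - a i)) \<le> ennreal e"
    by (rule bounded_lmeasurable_interval_cover[OF W]) (rule that)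
  have "A \<subseteq> (\<Union>i. {X (a i)..X (b i)})"
  proof
    fix x assume "x \<in> A"
    then obtain w i where "x = X w" "w \<in> {a i..b i}"
      using A ab(2) by blast
    then have "x \<in> {X (a i)..X (b i)}"
      using X(1) by (auto simp: monoD)
    then show "x \<in> (\<Union>i. {X (a i)..X (b i)})"
      by blast
  qed
  then have "emeasure lborel A \<le> emeasure lborel (\<Union>i. {X (a i)..X (b i)})"
    by (intro emeasure_mono) auto
  also have "\<dots> \<le> (\<Sum>i. emeasure lborel {X (a i)..X (b i)})"
    by (intro emeasure_subadditive_countably) auto
  also have "\<dots> \<le> (\<Sum>i. ennreal (b i - a i))"
  proof (intro suminf_le)
    fix i
    have "X (a i) \<le> X (b i)"
      using X(1) ab(1) by (simp add: monoD)
    moreover have "X (b i) - X (a i) \<le> b i - a i"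
      using lipschitz_onD[OF X(2), of "b i" "a i"] ab(1)[of i] by (simp add: dist_real_def)
    ultimately show "emeasure lborel {X (a i)..X (b i)} \<le> ennreal (b i - a i)"
      by (simp add: ennreal_leI)
  qed auto
  finally show ?thesis
    using ab(3) by simp
qed

text \<open>The graph over \<open>K\<close> is parametrised by \<open>\<phi>\<close>, which expands distances on \<open>K\<close>; its inverse extends to the monotone
  1-Lipschitz function \<open>X\<close>.\<close>
locale M_piece =
  fixes I :: "real set" and f :: "real \<Rightarrow> real" and a b c C :: real and K :: "real set"
  assumes f: "continuous_on I f" and ab: "{a..b} \<subseteq> I"
    and K: "compact K" "K \<subseteq> {a..b}" and c: "c \<ge> 1" and C: "C \<ge> 0"
    and M_left: "\<And>x y z. \<lbrakk>y \<in> K; a \<le> x; x < y; y < z; z \<le> b\<rbrakk> \<Longrightarrow>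
      dist (graph_pt f x) (graph_pt f y) \<le> c * dist (graph_pt f x) (graph_pt f z)"
    and M_right: "\<And>x y z. \<lbrakk>y \<in> K; a \<le> x; x < y; y < z; z \<le> b\<rbrakk> \<Longrightarrow>
      dist (graph_pt f z) (graph_pt f y) \<le> c * dist (graph_pt f z) (graph_pt f x)"
    and growth: "\<And>x y. \<lbrakk>x \<in> K; y \<in> K; x < y\<rbrakk> \<Longrightarrow> f y - f x \<le> C * (y - x)"
begin

text \<open>The extra 1 in \<open>C + 1\<close> turns monotonicity of \<open>C * x - f x\<close> on
  \<open>K\<close> into expansion by a factor of at least 1.\<close>

definition \<phi> :: "real \<Rightarrow> real" where "\<phi> x = (C + 1) * x - f x"

text \<open>McShane's extension formula with the positive part in place of the absolute value: every
  competitor is monotone and 1-Lipschitz in \<open>v\<close>, hence so is the infimum.\<close>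

definition X :: "real \<Rightarrow> real" where "X v = (INF k\<in>K. k + max (v - \<phi> k) 0)"

text \<open>Density is required along all short intervals containing \<open>u\<close>, not only
  centred ones; those ending at \<open>u\<close> give approximating points on either side.\<close>

definition good :: "real \<Rightarrow> bool" where
  "good u \<longleftrightarrow> X differentiable (at u) \<and>
    (\<forall>p. 0 \<le> p \<and> p < 1 \<longrightarrow> (\<exists>e>0. \<forall>s t. s < t \<and> s \<le> u \<and> u \<le> t \<and> t - s < e \<longrightarrow>
      p * (t - s) < measure lborel (\<phi> ` K \<inter> {s..t})))"

section \<open>The inverse parametrisation and its points of density and differentiability\<close>

lemma \<phi>_expand: "x \<in> K \<Longrightarrow> y \<in> K \<Longrightarrow> x \<le> y \<Longrightarrow> y - x \<le> \<phi> y - \<phi> x"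
  using growth[of x y] by (cases "x = y") (auto simp: \<phi>_def algebra_simps)

lemma continuous_f: "continuous_on {a..b} f"
  using f ab by (rule continuous_on_subset)

lemma continuous_\<phi>: "continuous_on K \<phi>"
  unfolding \<phi>_def using K(2) by (intro continuous_intros continuous_on_subset[OF continuous_f])

lemma compact_\<phi>_K: "compact (\<phi> ` K)"
  using continuous_\<phi> K(1) by (rule compact_continuous_image)

lemma X_bdd: "bdd_below ((\<lambda>k. k + max (v - \<phi> k) 0) ` K)"
  using K(2) by (intro bdd_belowI2[of _ a]) force

lemma X_mono: "K \<noteq> {} \<Longrightarrow> mono X"
  unfolding X_def by (intro monoI cINF_mono X_bdd) (auto intro!: bexI)

lemma X_lipschitz:
  assumes "K \<noteq> {}"
  shows "1-lipschitz_on UNIV X"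
proof (rule lipschitz_on_leI)
  fix v w :: real assume "v \<le> w"
  have "X w - (w - v) \<le> k + max (v - \<phi> k) 0" if "k \<in> K" for k
  proof -
    have "X w \<le> k + max (w - \<phi> k) 0"
      unfolding X_def using that by (intro cINF_lower X_bdd)
    then show ?thesis
      using \<open>v \<le> w\<close> by linarith
  qed
  then have "X w - (w - v) \<le> X v"
    unfolding X_def[of v] using assms by (intro cINF_greatest)
  moreover have "X v \<le> X w"
    using X_mono[OF assms] \<open>v \<le> w\<close> by (rule monoD)
  ultimately show "dist (X v) (X w) \<le> 1 * dist v w"
    using \<open>v \<le> w\<close> by (simp add: dist_real_def)
qed simp

text \<open>A competitor \<open>k'\<close> to the left of \<open>k\<close> pays
  \<open>\<phi> k - \<phi> k'\<close>, which is at least \<open>k - k'\<close> by expansion; one to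
  the right is larger than \<open>k\<close> already.\<close>

lemma X_\<phi>:
  assumes "k \<in> K"
  shows "X (\<phi> k) = k"
proof (rule antisym)
  have "X (\<phi> k) \<le> k + max (\<phi> k - \<phi> k) 0"
    unfolding X_def using assms by (intro cINF_lower X_bdd)
  then show "X (\<phi> k) \<le> k"
    by simp
  have "k \<le> k' + max (\<phi> k - \<phi> k') 0" if "k' \<in> K" for k'
    using \<phi>_expand[of k' k] assms that by (cases "k' \<le> k") auto
  then show "k \<le> X (\<phi> k)"
    unfolding X_def using assms by (intro cINF_greatest) auto
qed

lemma negligible_not_good:
  assumes "K \<noteq> {}"
  shows "negligible {u \<in> \<phi> ` K. \<not> good u}"
proof -
  let ?U = "\<phi> ` K"
  define S where "S p = {u\<in>?U. \<forall>e>0. \<exists>s t. s < t \<and> s \<le> u \<and> u \<le> t \<and> t - s < e \<and>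
    measure lborel (?U \<inter> {s..t}) \<le> p * (t - s)}" for p :: real
  \<comment> \<open>The bad sets \<open>S p\<close> increase with \<open>p\<close>, so countably
    many densities tending to 1 suffice.\<close>
  define p :: "nat \<Rightarrow> real" where "p n = 1 - 1 / Suc n" for n
  have p: "0 \<le> p n" "p n < 1" for n
    by (auto simp: p_def)
  have "negligible {u \<in> ?U. \<not> X differentiable (at u)}"
    using assms compact_\<phi>_K by (intro negligible_nondifferentiable X_mono X_lipschitz compact_imp_bounded)
  moreover have "negligible (\<Union>n. S (p n))"
    unfolding S_def using compact_\<phi>_K p
    by (intro negligible_countable_Union) (auto intro!: negligible_low_density_points simp: compact_imp_bounded compact_imp_closed borel_closed)
  ultimately have neg: "negligible ({u \<in> ?U. \<not> X differentiable (at u)} \<union> (\<Union>n. S (p n)))"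
    by (rule negligible_Un)
  have "u \<in> (\<Union>n. S (p n))" if u: "u \<in> ?U" "\<not> good u" "X differentiable (at u)" for u
  proof -
    obtain q where q: "0 \<le> q" "q < 1" and bad: "\<And>e. e > 0 \<Longrightarrow> \<exists>s t. s < t \<and> s \<le> u \<and> u \<le> t \<and> t - s < e \<and>
        measure lborel (?U \<inter> {s..t}) \<le> q * (t - s)"
      using u(2,3) unfolding good_def by (auto simp: not_less) (meson not_less)
    obtain n where "1 / Suc n < 1 - q"
      using q reals_Archimedean[of "1 - q"] by (auto simp: inverse_eq_divide)
    then have "q \<le> p n"
      by (simp add: p_def)
    have "\<exists>s t. s < t \<and> s \<le> u \<and> u \<le> t \<and> t - s < e \<and> measure lborel (?U \<inter> {s..t}) \<le> p n * (t - s)" if "e > 0" for e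
    proof -
      obtain s t where st: "s < t" "s \<le> u" "u \<le> t" "t - s < e" "measure lborel (?U \<inter> {s..t}) \<le> q * (t - s)"
        using bad[OF \<open>e > 0\<close>] by blast
      moreover have "q * (t - s) \<le> p n * (t - s)"
        using st \<open>q \<le> p n\<close> by (intro mult_right_mono) auto
      ultimately show ?thesis
        by (meson order_trans)
    qed
    then show ?thesis
      using u(1) unfolding S_def by blast
  qed
  then show ?thesis
    by (intro negligible_subset[OF neg]) blast
qed

text \<open>If the outer fraction \<open>\<kappa>\<close> of a short interval ending at
  \<open>u\<close> contained no value of \<open>\<phi>\<close> on \<open>K\<close>, the density in
  that interval could not exceed \<open>p < 1\<close>.\<close>

lemma good_dense:
  assumes u: "good u" and \<kappa>: "\<kappa> > 0"
  shows "\<exists>\<eta>>0. \<forall>r. 0 < r \<and> r < \<eta> \<longrightarrow>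
    (\<exists>k\<in>K. u + (1 - \<kappa>) * r \<le> \<phi> k \<and> \<phi> k \<le> u + r) \<and> (\<exists>k\<in>K. u - r \<le> \<phi> k \<and> \<phi> k \<le> u - (1 - \<kappa>) * r)"
proof -
  \<comment> \<open>\<open>\<kappa>\<close> may exceed 1, while \<open>good\<close> speaks of
    nonnegative densities.\<close>
  define p where "p = max 0 (1 - \<kappa>)"
  have p: "0 \<le> p" "p < 1" "1 - \<kappa> \<le> p"
    using \<kappa> by (auto simp: p_def)
  obtain e where e: "e > 0" "\<And>s t. \<lbrakk>s < t; s \<le> u; u \<le> t; t - s < e\<rbrakk> \<Longrightarrow>
      p * (t - s) < measure lborel (\<phi> ` K \<inter> {s..t})"
    using u p(1,2) unfolding good_def by blast
  have "(\<exists>k\<in>K. u + (1 - \<kappa>) * r \<le> \<phi> k \<and> \<phi> k \<le> u + r) \<and> (\<exists>k\<in>K. u - r \<le> \<phi> k \<and> \<phi> k \<le> u - (1 - \<kappa>) * r)"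
    if r: "0 < r" "r < e" for r
  proof
    have le: "(1 - \<kappa>) * r \<le> p * r" "0 \<le> p * r"
      using p r by (auto intro: mult_right_mono)
    show "\<exists>k\<in>K. u + (1 - \<kappa>) * r \<le> \<phi> k \<and> \<phi> k \<le> u + r"
    proof (rule ccontr)
      assume neg: "\<not> ?thesis"
      have "\<phi> ` K \<inter> {u..u + r} \<subseteq> {u..u + p * r}"
        using neg le by (force simp: not_le)
      then have "measure lborel (\<phi> ` K \<inter> {u..u + r}) \<le> measure lborel {u..u + p * r}"
        using compact_\<phi>_K by (intro measure_mono_fmeasurable bounded_fmeasurable_lborel)
          (auto simp: compact_imp_closed borel_closed)
      then show False
        using e(2)[of u "u + r"] r le by simp
    qed
    show "\<exists>k\<in>K. u - r \<le> \<phi> k \<and> \<phi> k \<le> u - (1 - \<kappa>) * r"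
    proof (rule ccontr)
      assume neg: "\<not> ?thesis"
      have "\<phi> ` K \<inter> {u - r..u} \<subseteq> {u - p * r..u}"
        using neg le by (force simp: not_le)
      then have "measure lborel (\<phi> ` K \<inter> {u - r..u}) \<le> measure lborel {u - p * r..u}"
        using compact_\<phi>_K by (intro measure_mono_fmeasurable bounded_fmeasurable_lborel)
          (auto simp: compact_imp_closed borel_closed)
      then show False
        using e(2)[of "u - r" u] r le by simp
    qed
  qed
  then show ?thesis
    using e(1) by blast
qed

text \<open>\<open>vertical_right\<close> treats the right side. The left side is the same lemma for
  the point reflection at \<open>- x\<close>; its M-hypothesis is then \<open>M_right\<close>, which
  is why the locale carries both forms.\<close>

lemma vertical_point:
  assumes x: "x \<in> K" and "good (\<phi> x)" and D: "(X has_real_derivative 0) (at (\<phi> x))"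
  shows "\<forall>\<^sub>F y in at x. (f y - f x) / (y - x) \<le> t"
proof -
  have flat: "\<exists>\<eta>>0. \<forall>k\<in>K. \<bar>\<phi> k - \<phi> x\<bar> < \<eta> \<longrightarrow> \<bar>k - x\<bar> \<le> \<kappa> * \<bar>\<phi> k - \<phi> x\<bar>" if "\<kappa> > 0" for \<kappa>
  proof -
    have "\<forall>\<^sub>F v in at (\<phi> x). dist ((X v - X (\<phi> x)) / (v - \<phi> x)) 0 < \<kappa>"
      using D that unfolding has_field_derivative_iff by (rule tendstoD)
    then obtain \<eta> where \<eta>: "\<eta> > 0" "\<And>v. \<lbrakk>v \<noteq> \<phi> x; dist v (\<phi> x) < \<eta>\<rbrakk> \<Longrightarrow> dist ((X v - X (\<phi> x)) / (v - \<phi> x)) 0 < \<kappa>"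
      unfolding eventually_at by auto
    have "\<bar>k - x\<bar> \<le> \<kappa> * \<bar>\<phi> k - \<phi> x\<bar>" if k: "k \<in> K" "\<bar>\<phi> k - \<phi> x\<bar> < \<eta>" for k
    proof (cases "\<phi> k = \<phi> x")
      case True
      then show ?thesis
        using X_\<phi>[OF x] X_\<phi>[OF k(1)] by simp
    next
      case False
      then have "dist ((k - x) / (\<phi> k - \<phi> x)) 0 < \<kappa>"
        using \<eta>(2)[of "\<phi> k"] k X_\<phi> x by (simp add: dist_real_def)
      then have "\<bar>k - x\<bar> / \<bar>\<phi> k - \<phi> x\<bar> < \<kappa>"
        by (simp add: dist_real_def abs_divide)
      then show ?thesis
        using False by (simp add: pos_divide_less_eq)
    qed
    with \<eta>(1) show ?thesis by blast
  qed
  \<comment> \<open>\<open>vertical_right\<close> takes a nonnegative \<open>T\<close>, hence the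
    bound \<open>- \<bar>t\<bar>\<close>, which is at most \<open>t\<close>.\<close>
  have right: "\<exists>\<eta>>0. \<forall>z. x < z \<and> z < x + \<eta> \<longrightarrow> (f z - f x) / (z - x) \<le> - \<bar>t\<bar>"
  proof (rule vertical_right[where K = K and a = a and b = b and c = c and C = C and \<phi> = \<phi>])
    fix \<kappa> :: real assume "\<kappa> > 0"
    then show "\<exists>\<eta>>0. \<forall>k\<in>K. x < k \<and> \<phi> k - \<phi> x < \<eta> \<longrightarrow> k - x \<le> \<kappa> * (\<phi> k - \<phi> x)"
      using flat[of \<kappa>] \<phi>_expand[OF x] by fastforce
    show "\<exists>\<eta>>0. \<forall>r. 0 < r \<and> r < \<eta> \<longrightarrow> (\<exists>k\<in>K. \<phi> x + (1 - \<kappa>) * r \<le> \<phi> k \<and> \<phi> k \<le> \<phi> x + r)"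
      using good_dense[OF assms(2) \<open>\<kappa> > 0\<close>] by blast
  qed (use continuous_f K x c C M_left \<phi>_expand in \<open>simp_all add: \<phi>_def\<close>)
  have left: "\<exists>\<eta>>0. \<forall>z. - x < z \<and> z < - x + \<eta> \<longrightarrow> (- f (- z) - - f (- (- x))) / (z - (- x)) \<le> - \<bar>t\<bar>"
  proof (rule vertical_right[where K = "uminus ` K" and a = "- b" and b = "- a" and c = c and C = C and \<phi> = "\<lambda>y. - \<phi> (- y)"])
    show "continuous_on {- b..- a} (\<lambda>z. - f (- z))"
      by (intro continuous_intros continuous_on_compose2[OF continuous_f]) auto
    show "compact (uminus ` K)"
      using K(1) by (rule compact_negations)
    show "dist (graph_pt (\<lambda>z. - f (- z)) r) (graph_pt (\<lambda>z. - f (- z)) y)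
        \<le> c * dist (graph_pt (\<lambda>z. - f (- z)) r) (graph_pt (\<lambda>z. - f (- z)) z)"
      if "y \<in> uminus ` K" "- b \<le> r" "r < y" "y < z" "z \<le> - a" for r y z
      unfolding dist_graph_pt_point_reflection using that by (intro M_right) auto
    show "- \<phi> (- r) = (C + 1) * r - - f (- r)" for r
      by (simp add: \<phi>_def)
    show "s - r \<le> - \<phi> (- s) - - \<phi> (- r)" if "r \<in> uminus ` K" "s \<in> uminus ` K" "r \<le> s" for r s
      using \<phi>_expand[of "- s" "- r"] that by auto
    fix \<kappa> :: real assume "\<kappa> > 0"
    obtain \<eta> where \<eta>: "\<eta> > 0" "\<And>k. \<lbrakk>k \<in> K; \<bar>\<phi> k - \<phi> x\<bar> < \<eta>\<rbrakk> \<Longrightarrow> \<bar>k - x\<bar> \<le> \<kappa> * \<bar>\<phi> k - \<phi> x\<bar>"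
      using flat[OF \<open>\<kappa> > 0\<close>] by blast
    have "x - k \<le> \<kappa> * (\<phi> x - \<phi> k)" if "k \<in> K" "k < x" "\<phi> x - \<phi> k < \<eta>" for k
      using \<eta>(2)[of k] that \<phi>_expand[OF that(1) x] by simp
    then show "\<exists>\<eta>>0. \<forall>y\<in>uminus ` K. - x < y \<and> - \<phi> (- y) - - \<phi> (- (- x)) < \<eta> \<longrightarrow>
        y - - x \<le> \<kappa> * (- \<phi> (- y) - - \<phi> (- (- x)))"
      using \<eta>(1) by (intro exI[of _ \<eta>]) (auto simp: algebra_simps)
    obtain \<eta> where \<eta>: "\<eta> > 0" "\<And>r. \<lbrakk>0 < r; r < \<eta>\<rbrakk> \<Longrightarrow> \<exists>k\<in>K. \<phi> x - r \<le> \<phi> k \<and> \<phi> k \<le> \<phi> x - (1 - \<kappa>) * r"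
      using good_dense[OF assms(2) \<open>\<kappa> > 0\<close>] by blast
    have "\<exists>k\<in>uminus ` K. - \<phi> (- (- x)) + (1 - \<kappa>) * r \<le> - \<phi> (- k) \<and> - \<phi> (- k) \<le> - \<phi> (- (- x)) + r"
      if "0 < r" "r < \<eta>" for r
      using \<eta>(2)[OF that] by force
    then show "\<exists>\<eta>>0. \<forall>r. 0 < r \<and> r < \<eta> \<longrightarrow>
        (\<exists>k\<in>uminus ` K. - \<phi> (- (- x)) + (1 - \<kappa>) * r \<le> - \<phi> (- k) \<and> - \<phi> (- k) \<le> - \<phi> (- (- x)) + r)"
      using \<eta>(1) by blast
  qed (use K x c C in auto)
  obtain d1 where d1: "d1 > 0" "\<And>z. \<lbrakk>x < z; z < x + d1\<rbrakk> \<Longrightarrow> (f z - f x) / (z - x) \<le> - \<bar>t\<bar>"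
    using right by blast
  obtain d2 where d2: "d2 > 0" "\<And>z. \<lbrakk>- x < z; z < - x + d2\<rbrakk> \<Longrightarrow> (- f (- z) - - f (- (- x))) / (z - (- x)) \<le> - \<bar>t\<bar>"
    using left by blast
  have "(f y - f x) / (y - x) \<le> t" if y: "y \<noteq> x" "dist y x < min d1 d2" for y
  proof (cases "x < y")
    case True
    then show ?thesis
      using d1(2)[of y] y by (auto simp: dist_real_def)
  next
    case False
    then have "(- f y - - f x) / (- y - (- x)) \<le> - \<bar>t\<bar>"
      using d2(2)[of "- y"] y by (auto simp: dist_real_def)
    moreover have "(- f y - - f x) / (- y - (- x)) = (f y - f x) / (y - x)"
      by (metis minus_diff_minus minus_divide_divide)
    ultimately show ?thesis
      by linarith
  qed
  then show ?thesis
    unfolding eventually_at using d1(1) d2(1) by (intro exI[of _ "min d1 d2"]) auto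
qed

text \<open>By the definition of \<open>\<phi>\<close>, the slope of \<open>f\<close> along
  \<open>K\<close> is \<open>C + 1\<close> minus the reciprocal of a quotient of \<open>X\<close>.
  For the density, \<open>X\<close> spreads a parameter interval over the neighbourhood of
  \<open>x\<close>, and points outside \<open>K\<close> can only come from parameters outside the
  image of \<open>K\<close>.\<close>

lemma nonvertical_point:
  assumes x: "x \<in> K" and u: "good (\<phi> x)" and D: "(X has_real_derivative \<xi>) (at (\<phi> x))" and "\<xi> > 0"
  shows "((\<lambda>y. (f y - f x) / (y - x)) \<longlongrightarrow> C + 1 - 1 / \<xi>) (at x within K)"
    and "\<kappa> > 0 \<Longrightarrow> \<forall>\<^sub>F \<delta> in at_right 0. measure lborel ({x-\<delta><..<x+\<delta>} - K) \<le> \<kappa> * \<delta>"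
proof -
  have K_ne: "K \<noteq> {}"
    using x by blast
  have lim: "((\<lambda>v. (X v - X (\<phi> x)) / (v - \<phi> x)) \<longlongrightarrow> \<xi>) (at (\<phi> x))"
    using D unfolding has_field_derivative_iff .
  have \<phi>_inj: "\<phi> y \<noteq> \<phi> x" if "y \<in> K" "y \<noteq> x" for y
    using X_\<phi> x that by metis
  have "filterlim \<phi> (at (\<phi> x)) (at x within K)"
    unfolding filterlim_at using continuous_\<phi> x \<phi>_inj
    by (auto simp: continuous_on_def eventually_at_filter)
  then have "((\<lambda>y. (X (\<phi> y) - X (\<phi> x)) / (\<phi> y - \<phi> x)) \<longlongrightarrow> \<xi>) (at x within K)"
    by (rule filterlim_compose[OF lim])
  then have "((\<lambda>y. C + 1 - inverse ((X (\<phi> y) - X (\<phi> x)) / (\<phi> y - \<phi> x))) \<longlongrightarrow> C + 1 - inverse \<xi>) (at x within K)"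
    using \<open>\<xi> > 0\<close> by (intro tendsto_intros) auto
  moreover have "\<forall>\<^sub>F y in at x within K. C + 1 - inverse ((X (\<phi> y) - X (\<phi> x)) / (\<phi> y - \<phi> x)) = (f y - f x) / (y - x)"
    unfolding eventually_at_filter
  proof (intro always_eventually allI impI)
    fix y assume y: "y \<noteq> x" "y \<in> K"
    have "(C + 1) * (y - x) - (\<phi> y - \<phi> x) = f y - f x"
      by (simp add: \<phi>_def algebra_simps)
    then have "(f y - f x) / (y - x) = C + 1 - (\<phi> y - \<phi> x) / (y - x)"
      using y by (simp add: divide_simps)
    then show "C + 1 - inverse ((X (\<phi> y) - X (\<phi> x)) / (\<phi> y - \<phi> x)) = (f y - f x) / (y - x)"
      using X_\<phi> x y by simp
  qed
  ultimately show "((\<lambda>y. (f y - f x) / (y - x)) \<longlongrightarrow> C + 1 - 1 / \<xi>) (at x within K)"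
    using Lim_transform_eventually by (simp add: inverse_eq_divide)
  show "\<forall>\<^sub>F \<delta> in at_right 0. measure lborel ({x-\<delta><..<x+\<delta>} - K) \<le> \<kappa> * \<delta>" if "\<kappa> > 0"
  proof -
    have "\<forall>\<^sub>F v in at (\<phi> x). \<xi> / 2 < (X v - X (\<phi> x)) / (v - \<phi> x)"
      using order_tendstoD(1)[OF lim, of "\<xi> / 2"] \<open>\<xi> > 0\<close> by simp
    then obtain d where d: "d > 0" "\<And>v. \<lbrakk>v \<noteq> \<phi> x; dist v (\<phi> x) < d\<rbrakk> \<Longrightarrow> \<xi> / 2 < (X v - x) / (v - \<phi> x)"
      unfolding eventually_at using X_\<phi>[OF x] by auto
    \<comment> \<open>Calibrated for \<open>\<rho> = 2 * \<delta> / \<xi>\<close>: the missing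
      parameters in an interval of length \<open>2 * \<rho>\<close> then measure less than
      \<open>\<kappa> * \<xi> / 4 * (2 * \<rho>) = \<kappa> * \<delta>\<close>.\<close>
    define p where "p = max 0 (1 - \<kappa> * \<xi> / 4)"
    have p: "0 \<le> p" "p < 1" "1 - \<kappa> * \<xi> / 4 \<le> p"
      using \<open>\<kappa> > 0\<close> \<open>\<xi> > 0\<close> by (auto simp: p_def)
    obtain e where e: "e > 0" "\<And>s t. \<lbrakk>s < t; s \<le> \<phi> x; \<phi> x \<le> t; t - s < e\<rbrakk> \<Longrightarrow>
        p * (t - s) < measure lborel (\<phi> ` K \<inter> {s..t})"
      using u p(1,2) unfolding good_def by blast
    define m where "m = \<xi> / 2 * min d (e / 2)"
    have "m > 0"
      using d(1) e(1) \<open>\<xi> > 0\<close> by (simp add: m_def)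
    have "measure lborel ({x-\<delta><..<x+\<delta>} - K) \<le> \<kappa> * \<delta>" if \<delta>: "0 < \<delta>" "\<delta> < m" for \<delta>
    proof -
      \<comment> \<open>Near \<open>\<phi> x\<close> the quotients of \<open>X\<close> exceed
        \<open>\<xi> / 2\<close>, so a parameter interval of this radius covers the
        \<open>\<delta>\<close>-neighbourhood of \<open>x\<close>.\<close>
      define \<rho> where "\<rho> = 2 * \<delta> / \<xi>"
      have "\<rho> < min d (e / 2)"
        using \<delta>(2) \<open>\<xi> > 0\<close> unfolding \<rho>_def m_def by (simp only: pos_divide_less_eq) (simp add: mult.commute)
      then have \<rho>: "0 < \<rho>" "\<rho> < d" "2 * \<rho> < e" "\<xi> * \<rho> = 2 * \<delta>"
        using \<delta> \<open>\<xi> > 0\<close> by (auto simp: \<rho>_def)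
      let ?J = "{\<phi> x - \<rho>..\<phi> x + \<rho>}"
      define W where "W = ?J - \<phi> ` K"
      have W: "bounded W" "W \<in> sets borel"
        using compact_\<phi>_K by (auto simp: W_def compact_imp_closed borel_closed intro: bounded_subset[OF bounded_closed_interval])
      have "measure lborel ?J = measure lborel (\<phi> ` K \<inter> ?J) + measure lborel W"
      proof -
        have "?J = (\<phi> ` K \<inter> ?J) \<union> W"
          by (auto simp: W_def)
        moreover have "measure lborel ((\<phi> ` K \<inter> ?J) \<union> W) = measure lborel (\<phi> ` K \<inter> ?J) + measure lborel W"
        proof (rule measure_Union)
          have "bounded (\<phi> ` K \<inter> ?J)"
            by (intro bounded_Int) auto
          then show "emeasure lborel (\<phi> ` K \<inter> ?J) \<noteq> \<infinity>" "emeasure lborel W \<noteq> \<infinity>"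
            using emeasure_bounded_finite W(1) by (metis infinity_ennreal_def order_less_irrefl)+
        qed (use W(2) compact_\<phi>_K in \<open>auto simp: W_def compact_imp_closed borel_closed\<close>)
        ultimately show ?thesis
          by simp
      qed
      moreover have "p * (2 * \<rho>) < measure lborel (\<phi> ` K \<inter> ?J)"
        using e(2)[of "\<phi> x - \<rho>" "\<phi> x + \<rho>"] \<rho> by simp
      moreover have "measure lborel ?J = 2 * \<rho>"
        using \<rho>(1) by simp
      ultimately have "measure lborel W < (1 - p) * (2 * \<rho>)"
        unfolding left_diff_distrib by linarith
      also have "\<dots> \<le> \<kappa> * \<xi> / 4 * (2 * \<rho>)"
        using p(3) \<rho>(1) by (intro mult_right_mono) auto
      also have "\<dots> = \<kappa> / 2 * (\<xi> * \<rho>)"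
        by simp
      also have "\<dots> = \<kappa> * \<delta>"
        unfolding \<rho>(4) by simp
      finally have "emeasure lebesgue W < ennreal (\<kappa> * \<delta>)"
        using W emeasure_eq_ennreal_measure[of lborel W] emeasure_bounded_finite[OF W(1)]
        by (simp add: ennreal_less_iff less_top)
      moreover have "{x-\<delta><..<x+\<delta>} - K \<subseteq> X ` W"
      proof
        fix y assume y: "y \<in> {x-\<delta><..<x+\<delta>} - K"
        have "\<xi> / 2 < (X (\<phi> x + \<rho>) - x) / \<rho>" "\<xi> / 2 < (x - X (\<phi> x - \<rho>)) / \<rho>"
          using d(2)[of "\<phi> x + \<rho>"] d(2)[of "\<phi> x - \<rho>"] \<rho> by (simp_all add: dist_real_def diff_divide_distrib)
        then have "\<delta> < X (\<phi> x + \<rho>) - x" "\<delta> < x - X (\<phi> x - \<rho>)"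
          using \<rho>(1,4) by (simp_all add: pos_less_divide_eq)
        then have "X (\<phi> x - \<rho>) \<le> y" "y \<le> X (\<phi> x + \<rho>)"
          using y by auto
        moreover have "continuous_on ?J X"
          using lipschitz_on_continuous_on[OF X_lipschitz[OF K_ne]] continuous_on_subset by blast
        ultimately obtain v where v: "v \<in> ?J" "X v = y"
          using IVT'[of X "\<phi> x - \<rho>" y "\<phi> x + \<rho>"] \<rho>(1) by auto
        moreover have "v \<notin> \<phi> ` K"
          using v y X_\<phi> by auto
        ultimately show "y \<in> X ` W"
          by (auto simp: W_def)
      qed
      ultimately have "emeasure lborel ({x-\<delta><..<x+\<delta>} - K) \<le> ennreal (\<kappa> * \<delta>)"
        using W by (intro emeasure_subset_mono_lipschitz_image[OF X_mono[OF K_ne] X_lipschitz[OF K_ne], of W]) auto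
      then show ?thesis
        using \<open>\<kappa> > 0\<close> \<delta>(1) by (simp add: measure_def enn2real_leI)
    qed
    then show ?thesis
      unfolding eventually_at_right_field using \<open>m > 0\<close> by blast
  qed
qed

lemma good_imp_has_ap_deriv:
  assumes x: "x \<in> K" "a < x" "x < b" and u: "good (\<phi> x)"
  shows "\<exists>L. has_ap_deriv f I x L"
proof -
  have K_ne: "K \<noteq> {}"
    using x by blast
  have "x \<in> interior {a..b}"
    using x by simp
  then have int: "x \<in> interior I"
    using ab interior_mono by blast
  obtain \<xi> where \<xi>: "(X has_real_derivative \<xi>) (at (\<phi> x))"
    using u unfolding good_def real_differentiable_def by blast
  have "\<xi> \<ge> 0"
  proof (rule tendsto_lowerbound)
    show "((\<lambda>v. (X v - X (\<phi> x)) / (v - \<phi> x)) \<longlongrightarrow> \<xi>) (at (\<phi> x))"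
      using \<xi> unfolding has_field_derivative_iff .
    show "\<forall>\<^sub>F v in at (\<phi> x). 0 \<le> (X v - X (\<phi> x)) / (v - \<phi> x)"
      using monoD[OF X_mono[OF K_ne], of "\<phi> x"] monoD[OF X_mono[OF K_ne], of _ "\<phi> x"]
      by (intro always_eventually allI) (metis diff_ge_0_iff_ge diff_le_0_iff_le divide_nonneg_nonneg divide_nonpos_nonpos linear)
  qed simp
  then consider "\<xi> = 0" | "\<xi> > 0"
    by linarith
  then show ?thesis
  proof cases
    case 1
    then show ?thesis
      using has_ap_deriv_MInf[OF f int vertical_point[OF x(1) u]] \<xi> by blast
  next
    case 2
    have "K \<in> sets borel"
      using K(1) by (simp add: compact_imp_closed borel_closed)
    then show ?thesis
      using has_ap_deriv_relative[OF f int _ nonvertical_point(2,1)[OF x(1) u \<xi> 2]] by blast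
  qed
qed

lemma hausdorff1_no_ap_deriv:
  "hausdorff1 (graph_pt f ` {x\<in>K. a < x \<and> x < b \<and> \<not> (\<exists>L. has_ap_deriv f I x L)}) = 0"
proof (cases "K = {}")
  case True
  then show ?thesis
    using hausdorff1_null_subset[OF hausdorff1_sing] by simp
next
  case False
  define N where "N = {u \<in> \<phi> ` K. \<not> good u}"
  \<comment> \<open>At \<open>v = \<phi> x\<close> with \<open>x \<in> K\<close> the second
    coordinate is \<open>(C + 1) * x - \<phi> x = f x\<close>, so this curve passes through the
    graph over \<open>K\<close>.\<close>
  let ?h = "\<lambda>v. (X v, (C + 1) * X v - v)"
  have "hausdorff1 (?h ` N) = 0"
  proof (rule hausdorff1_null_lipschitz_image)
    show "negligible N"
      unfolding N_def using False by (rule negligible_not_good)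
    show "bounded N"
      using compact_imp_bounded[OF compact_\<phi>_K] by (rule bounded_subset) (auto simp: N_def)
    show "(C + 3)-lipschitz_on N ?h"
    proof (rule lipschitz_onI)
      fix v w
      have X: "\<bar>X v - X w\<bar> \<le> \<bar>v - w\<bar>"
        using lipschitz_onD[OF X_lipschitz[OF False], of v w] by (simp add: dist_real_def)
      have "dist (?h v) (?h w) \<le> \<bar>X v - X w\<bar> + \<bar>((C + 1) * X v - v) - ((C + 1) * X w - w)\<bar>"
        unfolding dist_Pair_Pair dist_real_def
        using sqrt_sum_squares_le_sum_abs[of "\<bar>X v - X w\<bar>" "\<bar>((C + 1) * X v - v) - ((C + 1) * X w - w)\<bar>"] by simp
      also have "((C + 1) * X v - v) - ((C + 1) * X w - w) = (C + 1) * (X v - X w) - (v - w)"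
        by (simp add: algebra_simps)
      also have "\<bar>\<dots>\<bar> \<le> (C + 1) * \<bar>X v - X w\<bar> + \<bar>v - w\<bar>"
        using C abs_triangle_ineq4[of "(C + 1) * (X v - X w)" "v - w"] by (simp add: abs_mult)
      finally have "dist (?h v) (?h w) \<le> (C + 2) * \<bar>X v - X w\<bar> + \<bar>v - w\<bar>"
        by (simp add: algebra_simps)
      also have "\<dots> \<le> (C + 2) * \<bar>v - w\<bar> + \<bar>v - w\<bar>"
        using X C by (intro add_right_mono mult_left_mono) auto
      finally show "dist (?h v) (?h w) \<le> (C + 3) * dist v w"
        by (simp add: dist_real_def algebra_simps)
    qed (use C in simp)
  qed
  moreover have "graph_pt f ` {x\<in>K. a < x \<and> x < b \<and> \<not> (\<exists>L. has_ap_deriv f I x L)} \<subseteq> ?h ` N"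
  proof (rule image_subsetI)
    fix x assume "x \<in> {x\<in>K. a < x \<and> x < b \<and> \<not> (\<exists>L. has_ap_deriv f I x L)}"
    then have x: "x \<in> K" "a < x" "x < b" "\<not> (\<exists>L. has_ap_deriv f I x L)"
      by auto
    then have "\<phi> x \<in> N"
      using good_imp_has_ap_deriv by (auto simp: N_def)
    moreover have "graph_pt f x = ?h (\<phi> x)"
      using X_\<phi>[OF x(1)] by (simp add: graph_pt_def \<phi>_def)
    ultimately show "graph_pt f x \<in> ?h ` N"
      by blast
  qed
  ultimately show ?thesis
    by (rule hausdorff1_null_subset)
qed

end

section \<open>Countable decomposition of the M-points\<close>

text \<open>With an infinite derivative, \<open>f x\<close> and \<open>f z\<close> lie on opposite
  sides of \<open>f y\<close>, so both coordinate differences shrink and the constant 1 works; the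
  sign \<open>s\<close> covers both infinities. With a finite derivative \<open>D\<close>, the chord
  to \<open>x\<close> is at most \<open>\<bar>D\<bar> + 2\<close> times its horizontal part, and
  that is less than \<open>\<bar>x - z\<bar>\<close>.\<close>

lemma deriv_imp_M_point:
  assumes "y \<in> I" "has_fin_or_inf_deriv f I y"
  shows "M_point f I y"
proof -
  let ?q = "\<lambda>t. (f t - f y) / (t - y)"
  have mono: "M_point f I y" if ev: "\<forall>\<^sub>F t in at y within I. s * ?q t > 0" for s :: real
  proof -
    obtain d where d: "d > 0" "\<And>t. \<lbrakk>t \<in> I; t \<noteq> y; dist t y < d\<rbrakk> \<Longrightarrow> s * ?q t > 0"
      using ev unfolding eventually_at by auto
    have "dist (graph_pt f x) (graph_pt f y) \<le> 1 * dist (graph_pt f x) (graph_pt f z)"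
      if x: "x \<in> I \<inter> {y-d<..<y}" and z: "z \<in> I \<inter> {y<..<y+d}" for x z
    proof -
      have "s * ?q x > 0" "s * ?q z > 0"
        using d(2)[of x] d(2)[of z] x z by (auto simp: dist_real_def)
      then have "s * (f x - f y) < 0" "s * (f z - f y) > 0"
        using x z by (auto simp: zero_less_divide_iff)
      then have "\<bar>f x - f y\<bar> \<le> \<bar>f x - f z\<bar>"
        by (auto simp: mult_less_0_iff zero_less_mult_iff)
      moreover have "\<bar>x - y\<bar> \<le> \<bar>x - z\<bar>"
        using x z by auto
      ultimately show ?thesis
        unfolding graph_pt_def dist_Pair_Pair dist_real_def
        by (simp add: add_mono abs_le_square_iff)
    qed
    then have "M_c_point f I 1 y"
      unfolding M_c_point_def using assms(1) d(1) by blast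
    then show ?thesis
      unfolding M_point_def by (intro exI[of _ 1]) simp
  qed
  consider D where "(?q \<longlongrightarrow> D) (at y within I)" | "filterlim ?q at_top (at y within I)"
    | "filterlim ?q at_bot (at y within I)"
    using assms(2) unfolding has_fin_or_inf_deriv_def by blast
  then show ?thesis
  proof cases
    case 1
    have "\<forall>\<^sub>F t in at y within I. dist (?q t) D < 1"
      using 1 by (rule tendstoD) simp
    then obtain d where d: "d > 0" "\<And>t. \<lbrakk>t \<in> I; t \<noteq> y; dist t y < d\<rbrakk> \<Longrightarrow> dist (?q t) D < 1"
      unfolding eventually_at by auto
    define c where "c = \<bar>D\<bar> + 2"
    have "dist (graph_pt f x) (graph_pt f y) \<le> c * dist (graph_pt f x) (graph_pt f z)"
      if x: "x \<in> I \<inter> {y-d<..<y}" and z: "z \<in> I \<inter> {y<..<y+d}" for x z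
    proof -
      have "dist (?q x) D < 1"
        using x by (intro d(2)) (auto simp: dist_real_def)
      then have "\<bar>?q x\<bar> \<le> \<bar>D\<bar> + 1"
        unfolding dist_real_def by linarith
      then have "\<bar>f x - f y\<bar> \<le> (\<bar>D\<bar> + 1) * \<bar>x - y\<bar>"
        using x by (simp add: abs_divide pos_divide_le_eq)
      then have "dist (graph_pt f x) (graph_pt f y) \<le> c * \<bar>x - y\<bar>"
        using dist_graph_pt_le[of f x y] by (simp add: c_def algebra_simps)
      also have "\<dots> \<le> c * \<bar>x - z\<bar>"
        using x z by (intro mult_left_mono) (auto simp: c_def)
      also have "\<dots> \<le> c * dist (graph_pt f x) (graph_pt f z)"
        by (intro mult_left_mono dist_graph_pt_ge) (auto simp: c_def)
      finally show ?thesis .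
    qed
    then have "M_c_point f I c y"
      unfolding M_c_point_def using assms(1) d(1) by blast
    then show ?thesis
      unfolding M_point_def by (intro exI[of _ c]) (simp add: c_def)
  next
    case 2
    then have "\<forall>\<^sub>F t in at y within I. 1 * ?q t > 0"
      unfolding filterlim_at_top_dense by simp
    then show ?thesis
      by (rule mono)
  next
    case 3
    then have "\<forall>\<^sub>F t in at y within I. ?q t < 0"
      unfolding filterlim_at_bot_dense by blast
    then have "\<forall>\<^sub>F t in at y within I. (-1) * ?q t > 0"
      by eventually_elim linarith
    then show ?thesis
      by (rule mono)
  qed
qed

text \<open>The single index \<open>n\<close> bounds the M-constant, the slope of the cone and the inverse of the radius; the M-condition is
  stated symmetrically in its two sides.\<close>
definition M_at :: "(real \<Rightarrow> real) \<Rightarrow> real set \<Rightarrow> nat \<Rightarrow> real \<Rightarrow> bool" where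
  "M_at f I n y \<longleftrightarrow> (\<forall>x \<in> I \<inter> {y-1/n<..<y}. \<forall>z \<in> I \<inter> {y<..<y+1/n}.
     dist (graph_pt f x) (graph_pt f y) \<le> n * dist (graph_pt f x) (graph_pt f z) \<and>
     dist (graph_pt f z) (graph_pt f y) \<le> n * dist (graph_pt f z) (graph_pt f x))"

text \<open>The witness must lie in the far half of the window: for
  \<open>\<delta> = 2 * (y' - y)\<close> it then lies beyond \<open>y'\<close>, at most twice as far
  from \<open>y\<close>.\<close>

definition cone_right :: "(real \<Rightarrow> real) \<Rightarrow> real set \<Rightarrow> nat \<Rightarrow> real \<Rightarrow> bool" where
  "cone_right f I n y \<longleftrightarrow> (\<forall>\<delta>. 0 < \<delta> \<and> \<delta> < 1/n \<longrightarrow>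
     (\<exists>z \<in> I \<inter> {y+\<delta>/2<..<y+\<delta>}. f z - f y \<le> n * (z - y)))"

definition cone_left :: "(real \<Rightarrow> real) \<Rightarrow> real set \<Rightarrow> nat \<Rightarrow> real \<Rightarrow> bool" where
  "cone_left f I n y \<longleftrightarrow> (\<forall>\<delta>. 0 < \<delta> \<and> \<delta> < 1/n \<longrightarrow>
     (\<exists>x \<in> I \<inter> {y-\<delta><..<y-\<delta>/2}. f y - f x \<le> n * (y - x)))"

lemma M_at_uminus: "M_at (\<lambda>x. - f x) I n y \<longleftrightarrow> M_at f I n y"
  unfolding M_at_def dist_graph_pt_uminus ..

lemma eventually_inverse_nat_less:
  "0 < e \<Longrightarrow> \<forall>\<^sub>F n::nat in sequentially. 1 / n < e" for e :: real
  using order_tendstoD(2)[OF lim_inverse_n'] by simp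

text \<open>The symmetric form costs 1 in the constant: by the triangle inequality the distance from
  \<open>z\<close> to \<open>y\<close> is at most \<open>c + 1\<close> times that from
  \<open>x\<close> to \<open>z\<close>.\<close>

lemma M_point_imp_M_at:
  assumes "M_point f I y"
  shows "\<forall>\<^sub>F n in sequentially. M_at f I n y"
proof -
  obtain c e where c: "c \<ge> 1" and e: "e > 0" and M: "\<And>x z. \<lbrakk>x \<in> I \<inter> {y-e<..<y}; z \<in> I \<inter> {y<..<y+e}\<rbrakk> \<Longrightarrow>
      dist (graph_pt f x) (graph_pt f y) \<le> c * dist (graph_pt f x) (graph_pt f z)"
    using assms unfolding M_point_def M_c_point_def by blast
  have "\<forall>\<^sub>F n::nat in sequentially. c + 1 \<le> real n"
    using filterlim_real_sequentially unfolding filterlim_at_top by blast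
  with eventually_inverse_nat_less[OF e] show ?thesis
  proof eventually_elim
    case (elim n)
    show ?case
      unfolding M_at_def
    proof (intro ballI)
      fix x z assume x: "x \<in> I \<inter> {y-1/n<..<y}" and z: "z \<in> I \<inter> {y<..<y+1/n}"
      let ?d = "\<lambda>a b. dist (graph_pt f a) (graph_pt f b)"
      have le: "?d x y \<le> c * ?d x z"
        using x z elim by (intro M) auto
      have "c * ?d x z + ?d x z \<le> n * ?d x z"
        using mult_right_mono[OF elim(2), of "?d x z"] by (auto simp: algebra_simps)
      moreover have "?d z y \<le> ?d x z + ?d x y"
        using dist_triangle[of "graph_pt f z" "graph_pt f y" "graph_pt f x"] by (simp add: dist_commute)
      ultimately show "?d x y \<le> n * ?d x z \<and> ?d z y \<le> n * ?d z x"
        using le zero_le_dist[of "graph_pt f x" "graph_pt f z"] unfolding dist_commute[of "graph_pt f z" "graph_pt f x"]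
        by linarith
    qed
  qed
qed

section \<open>One-sided cone conditions away from approximate knot points\<close>

lemma full_density_imp_cone_right:
  assumes "full_density I (\<lambda>\<delta>. {y<..<y+\<delta>}) (\<lambda>z. (f z - f y) / (z - y) \<le> t)"
  shows "\<forall>\<^sub>F n in sequentially. cone_right f I n y"
proof -
  obtain \<eta> where \<eta>: "\<eta> > 0" "\<And>\<delta>. \<lbrakk>0 < \<delta>; \<delta> < \<eta>\<rbrakk> \<Longrightarrow>
      \<exists>z \<in> I \<inter> {y<..<y+\<delta>}. (f z - f y) / (z - y) \<le> t \<and> \<bar>z - y\<bar> > \<delta> / 2"
    by (rule full_density_imp_far_points[OF one_sided_right assms]) (rule that)
  have "\<forall>\<^sub>F n::nat in sequentially. t \<le> real n"
    using filterlim_real_sequentially unfolding filterlim_at_top by blast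
  with eventually_inverse_nat_less[OF \<eta>(1)] show ?thesis
  proof eventually_elim
    case (elim n)
    show ?case
      unfolding cone_right_def
    proof (intro allI impI)
      fix \<delta> :: real assume "0 < \<delta> \<and> \<delta> < 1 / n"
      then obtain z where z: "z \<in> I" "y < z" "z < y + \<delta>" "(f z - f y) / (z - y) \<le> t" "\<bar>z - y\<bar> > \<delta> / 2"
        using \<eta>(2)[of \<delta>] elim by auto
      then have "f z - f y \<le> t * (z - y)"
        by (simp add: pos_divide_le_eq)
      also have "\<dots> \<le> n * (z - y)"
        using elim z by (intro mult_right_mono) auto
      finally show "\<exists>z \<in> I \<inter> {y+\<delta>/2<..<y+\<delta>}. f z - f y \<le> n * (z - y)"
        using z by (intro bexI[of _ z]) auto
    qed
  qed
qed

lemma full_density_imp_cone_left: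
  assumes "full_density I (\<lambda>\<delta>. {y-\<delta><..<y}) (\<lambda>z. (f z - f y) / (z - y) \<le> t)"
  shows "\<forall>\<^sub>F n in sequentially. cone_left f I n y"
proof -
  obtain \<eta> where \<eta>: "\<eta> > 0" "\<And>\<delta>. \<lbrakk>0 < \<delta>; \<delta> < \<eta>\<rbrakk> \<Longrightarrow>
      \<exists>z \<in> I \<inter> {y-\<delta><..<y}. (f z - f y) / (z - y) \<le> t \<and> \<bar>z - y\<bar> > \<delta> / 2"
    by (rule full_density_imp_far_points[OF one_sided_left assms]) (rule that)
  have "\<forall>\<^sub>F n::nat in sequentially. t \<le> real n"
    using filterlim_real_sequentially unfolding filterlim_at_top by blast
  with eventually_inverse_nat_less[OF \<eta>(1)] show ?thesis
  proof eventually_elim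
    case (elim n)
    show ?case
      unfolding cone_left_def
    proof (intro allI impI)
      fix \<delta> :: real assume "0 < \<delta> \<and> \<delta> < 1 / n"
      then obtain x where x: "x \<in> I" "x < y" "y - \<delta> < x" "(f x - f y) / (x - y) \<le> t" "\<bar>x - y\<bar> > \<delta> / 2"
        using \<eta>(2)[of \<delta>] elim by auto
      have "(f y - f x) / (y - x) \<le> t"
        using x(4) by (metis minus_diff_eq minus_divide_divide)
      then have "f y - f x \<le> t * (y - x)"
        using x by (simp add: pos_divide_le_eq)
      also have "\<dots> \<le> n * (y - x)"
        using elim x by (intro mult_right_mono) auto
      finally show "\<exists>x \<in> I \<inter> {y-\<delta><..<y-\<delta>/2}. f y - f x \<le> n * (y - x)"
        using x by (intro bexI[of _ x]) auto
    qed
  qed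
qed

text \<open>If an upper derivate is not \<open>\<infinity>\<close>, the infimum defining it is not
  over the empty set, so some slope bound holds with full density. Lower derivates become upper ones
  for \<open>- f\<close>; the choices of \<open>g\<close> and \<open>Q\<close> encode the four
  cases.\<close>

lemma not_K_ap_imp_cone:
  assumes "y \<in> I" "y \<notin> K_ap f I"
  shows "\<exists>g \<in> {f, \<lambda>x. - f x}. \<exists>Q \<in> {cone_right, cone_left}. \<forall>\<^sub>F n in sequentially. Q g I n y"
proof -
  have q: "(- f z - - f y) / (z - y) \<le> - t \<longleftrightarrow> t \<le> (f z - f y) / (z - y)" for z t
    by (metis minus_diff_minus minus_divide_left neg_le_iff_le)
  have Inf: "\<exists>t. P t" if "Inf {ereal t | t. P t} \<noteq> \<infinity>" for P
    using that by (rule contrapos_np) (simp add: top_ereal_def)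
  have Sup: "\<exists>t. P t" if "Sup {ereal t | t. P t} \<noteq> -\<infinity>" for P
    using that by (rule contrapos_np) (simp add: bot_ereal_def)
  consider "ap_upper_right f I y \<noteq> \<infinity>" | "ap_upper_left f I y \<noteq> \<infinity>"
    | "ap_lower_right f I y \<noteq> -\<infinity>" | "ap_lower_left f I y \<noteq> -\<infinity>"
    using assms unfolding K_ap_def by blast
  then show ?thesis
  proof cases
    case 1
    obtain t where "full_density I (\<lambda>\<delta>. {y<..<y+\<delta>}) (\<lambda>z. (f z - f y) / (z - y) \<le> t)"
      using Inf[OF 1[unfolded ap_Dini_full_density]] by (rule exE)
    then have "\<forall>\<^sub>F n in sequentially. cone_right f I n y"
      by (rule full_density_imp_cone_right)
    then show ?thesis
      by blast
  next
    case 2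
    obtain t where "full_density I (\<lambda>\<delta>. {y-\<delta><..<y}) (\<lambda>z. (f z - f y) / (z - y) \<le> t)"
      using Inf[OF 2[unfolded ap_Dini_full_density]] by (rule exE)
    then have "\<forall>\<^sub>F n in sequentially. cone_left f I n y"
      by (rule full_density_imp_cone_left)
    then show ?thesis
      by blast
  next
    case 3
    obtain t where "full_density I (\<lambda>\<delta>. {y<..<y+\<delta>}) (\<lambda>z. t \<le> (f z - f y) / (z - y))"
      using Sup[OF 3[unfolded ap_Dini_full_density]] by (rule exE)
    then have "\<forall>\<^sub>F n in sequentially. cone_right (\<lambda>x. - f x) I n y"
      by (intro full_density_imp_cone_right[where t = "- t"]) (simp only: q)
    then show ?thesis
      by blast
  next
    case 4
    obtain t where "full_density I (\<lambda>\<delta>. {y-\<delta><..<y}) (\<lambda>z. t \<le> (f z - f y) / (z - y))"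
      using Sup[OF 4[unfolded ap_Dini_full_density]] by (rule exE)
    then have "\<forall>\<^sub>F n in sequentially. cone_left (\<lambda>x. - f x) I n y"
      by (intro full_density_imp_cone_left[where t = "- t"]) (simp only: q)
    then show ?thesis
      by blast
  qed
qed

text \<open>One cone suffices, opening from either point over the other. The window of length
  \<open>2 * (y' - y)\<close> has to stay below \<open>1 / n\<close>, hence the bound
  \<open>1 / (2 * real n)\<close>.\<close>

lemma cone_growth:
  assumes I: "is_interval I" and f: "continuous_on I f" and n: "n \<ge> 1"
    and yy: "y \<in> I" "y' \<in> I" "y < y'" "y' - y < 1 / (2 * real n)" and M: "M_at f I n y" "M_at f I n y'"
    and cone: "cone_right f I n y \<or> cone_left f I n y'"
  shows "f y' - f y \<le> 2 * real n * (1 + real n) * (y' - y)"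
proof -
  have I': "z \<in> I" if "x \<in> I" "y \<in> I" "x \<le> z" "z \<le> y" for x y z
    using I that by (meson mem_is_interval_1_I)
  have dbl: "2 * (y' - y) / 2 = y' - y"
    by (rule nonzero_mult_div_cancel_left) simp
  have half: "2 * (y' - y) < 1 / n"
    using yy(4) n by (simp add: field_simps)
  then have lt: "y' - y < 1 / n"
    using yy(3) by simp
  from cone show ?thesis
  proof
    assume "cone_right f I n y"
    then obtain z where z: "z \<in> I" "y + 2 * (y' - y) / 2 < z" "z < y + 2 * (y' - y)" "f z - f y \<le> n * (z - y)"
      unfolding cone_right_def using half yy(3) by (auto dest: spec[of _ "2 * (y' - y)"])
    have "y' < z"
      using z(2) dbl by linarith
    have "continuous_on {y'..z} f"
      using I'[OF yy(2) z(1)] by (intro continuous_on_subset[OF f]) auto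
    moreover have "dist (graph_pt f y) (graph_pt f y') \<le> n * dist (graph_pt f y) (graph_pt f w)"
      if "y' < w" "w \<le> z" for w
      using M(2) I'[OF yy(2) z(1), of w] that z yy lt half unfolding M_at_def by auto
    ultimately show ?thesis
      using z yy n \<open>y' < z\<close> by (intro cone_growth_right[where z = z]) auto
  next
    assume "cone_left f I n y'"
    then obtain x where x: "x \<in> I" "y' - 2 * (y' - y) < x" "x < y' - 2 * (y' - y) / 2" "f y' - f x \<le> n * (y' - x)"
      unfolding cone_left_def using half yy(3) by (auto dest: spec[of _ "2 * (y' - y)"])
    have "x < y"
      using x(3) dbl by linarith
    have "continuous_on {x..y} f"
      using I'[OF x(1) yy(1)] by (intro continuous_on_subset[OF f]) auto
    moreover have "dist (graph_pt f y') (graph_pt f y) \<le> n * dist (graph_pt f y') (graph_pt f w)"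
      if "x \<le> w" "w < y" for w
      using M(1) I'[OF x(1) yy(1), of w] that x yy lt half unfolding M_at_def by auto
    ultimately show ?thesis
      using x yy n \<open>x < y\<close> by (intro cone_growth_left[where x = x]) auto
  qed
qed

text \<open>For fixed \<open>x\<close> and \<open>z\<close> the M-condition is closed in
  \<open>y\<close> by continuity, and so is the slope bound, so both pass to
  \<open>closure B\<close>. As \<open>q - p < 1 / n\<close>, the M-radius of every point of
  \<open>B\<close> covers the whole interval.\<close>

lemma hausdorff1_null_piece:
  fixes f :: "real \<Rightarrow> real"
  assumes f: "continuous_on I f" and pq: "{p..q} \<subseteq> I" "q - p < 1 / n" and n: "n \<ge> 1" and C: "C \<ge> 0"
    and B: "B \<subseteq> {p<..<q}" "\<And>y. y \<in> B \<Longrightarrow> M_at f I n y"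
    and growth: "\<And>x y. \<lbrakk>x \<in> B; y \<in> B; x < y\<rbrakk> \<Longrightarrow> f y - f x \<le> C * (y - x)"
  shows "hausdorff1 (graph_pt f ` {x\<in>B. \<not> (\<exists>L. has_ap_deriv f I x L)}) = 0"
proof -
  have cont: "continuous_on {p..q} f"
    using f pq(1) by (rule continuous_on_subset)
  have cl: "closure B \<subseteq> {p..q}"
    using B(1) by (intro closure_minimal) auto
  have seq: "\<exists>X. (\<forall>i. X i \<in> B) \<and> X \<longlonglongrightarrow> x \<and> (\<lambda>i. f (X i)) \<longlonglongrightarrow> f x" if x: "x \<in> closure B" for x
  proof -
    obtain X where X: "\<And>i. X i \<in> B" "X \<longlonglongrightarrow> x"
      using x closure_sequential by blast
    moreover have "(\<lambda>i. f (X i)) \<longlonglongrightarrow> f x"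
      using X cl x closure_subset[of B] by (intro continuous_on_tendsto_compose[OF cont] always_eventually allI) blast+
    ultimately show ?thesis by blast
  qed
  have M_ev: "dist (graph_pt f x) (graph_pt f y) \<le> n * dist (graph_pt f x) (graph_pt f z) \<and>
      dist (graph_pt f z) (graph_pt f y) \<le> n * dist (graph_pt f z) (graph_pt f x)"
    if y: "y \<in> closure B" and xz: "p \<le> x" "x < y" "y < z" "z \<le> q" for x y z
  proof -
    obtain Y where Y: "\<And>i. Y i \<in> B" "Y \<longlonglongrightarrow> y" "(\<lambda>i. f (Y i)) \<longlonglongrightarrow> f y"
      using seq[OF y] by blast
    have "\<forall>\<^sub>F i in sequentially. x < Y i \<and> Y i < z"
      using order_tendstoD[OF Y(2)] xz by (auto simp: eventually_conj_iff)
    then have ev: "\<forall>\<^sub>F i in sequentially.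
        dist (graph_pt f x) (graph_pt f (Y i)) \<le> n * dist (graph_pt f x) (graph_pt f z) \<and>
        dist (graph_pt f z) (graph_pt f (Y i)) \<le> n * dist (graph_pt f z) (graph_pt f x)"
    proof eventually_elim
      case (elim i)
      have "Y i \<in> {p<..<q}"
        using B(1) Y(1) by blast
      then have "x \<in> I \<inter> {Y i - 1 / n<..<Y i}" "z \<in> I \<inter> {Y i<..<Y i + 1 / n}"
        using xz pq elim by auto
      then show ?case
        using B(2)[OF Y(1)[of i]] unfolding M_at_def by blast
    qed
    have lim: "(\<lambda>i. dist (graph_pt f w) (graph_pt f (Y i))) \<longlonglongrightarrow> dist (graph_pt f w) (graph_pt f y)" for w
      unfolding graph_pt_def using Y by (intro tendsto_intros)
    show ?thesis
      using tendsto_upperbound[OF lim[of x]] tendsto_upperbound[OF lim[of z]] ev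
      by (auto simp: eventually_conj_iff)
  qed
  interpret M_piece I f p q n C "closure B"
  proof
    show "continuous_on I f" "{p..q} \<subseteq> I" "closure B \<subseteq> {p..q}" "C \<ge> 0"
      by fact+
    show "compact (closure B)"
      using cl bounded_subset[OF bounded_closed_interval] by (auto simp: compact_eq_bounded_closed)
    show "1 \<le> real n"
      using n by simp
    show "f y - f x \<le> C * (y - x)" if xy: "x \<in> closure B" "y \<in> closure B" "x < y" for x y
    proof -
      obtain S where S: "\<And>i. S i \<in> B" "S \<longlonglongrightarrow> x" "(\<lambda>i. f (S i)) \<longlonglongrightarrow> f x"
        using seq[OF xy(1)] by blast
      obtain T where T: "\<And>i. T i \<in> B" "T \<longlonglongrightarrow> y" "(\<lambda>i. f (T i)) \<longlonglongrightarrow> f y"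
        using seq[OF xy(2)] by blast
      \<comment> \<open>The bound on \<open>B\<close> is available for ordered pairs only;
        \<open>m\<close> separates the two sequences eventually.\<close>
      obtain m where m: "x < m" "m < y"
        using dense xy(3) by blast
      have "\<forall>\<^sub>F i in sequentially. S i < m" "\<forall>\<^sub>F i in sequentially. m < T i"
        using order_tendstoD(2)[OF S(2) m(1)] order_tendstoD(1)[OF T(2) m(2)] .
      then have "\<forall>\<^sub>F i in sequentially. f (T i) - f (S i) \<le> C * (T i - S i)"
        by eventually_elim (auto intro!: growth S T)
      then show ?thesis
        using S T by (intro tendsto_le[OF trivial_limit_sequentially, of "\<lambda>i. C * (T i - S i)" _ "\<lambda>i. f (T i) - f (S i)"]
          tendsto_intros)
    qed
  qed (use M_ev in auto)
  show ?thesis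
    using B(1) closure_subset[of B] by (intro hausdorff1_null_subset[OF hausdorff1_no_ap_deriv] image_mono) auto
qed

lemma countable_interval_minus_interior:
  fixes I :: "real set"
  assumes "is_interval I"
  shows "countable (I - interior I)"
proof -
  define A where "A = {y\<in>I. \<forall>x\<in>I. y \<le> x}"
  define B where "B = {y\<in>I. \<forall>x\<in>I. x \<le> y}"
  have "A \<subseteq> {SOME y. y \<in> A}" "B \<subseteq> {SOME y. y \<in> B}"
    using someI[of "\<lambda>y. y \<in> A"] someI[of "\<lambda>y. y \<in> B"] unfolding A_def B_def by (auto intro: antisym)
  then have "countable (A \<union> B)"
    by (meson countable_Un countable_empty countable_insert countable_subset)
  moreover have "I - interior I \<subseteq> A \<union> B"
  proof
    fix y assume y: "y \<in> I - interior I"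
    show "y \<in> A \<union> B"
    proof (rule ccontr)
      assume "y \<notin> A \<union> B"
      then obtain x z where xz: "x \<in> I" "x < y" "z \<in> I" "y < z"
        using y unfolding A_def B_def by (auto simp: not_le)
      then have "{x<..<z} \<subseteq> I"
        by (auto intro: mem_is_interval_1_I[OF assms xz(1,3)])
      then have "y \<in> interior I"
        using xz by (intro interiorI[of "{x<..<z}"]) auto
      with y show False by blast
    qed
  qed
  ultimately show ?thesis
    using countable_subset by blast
qed

text \<open>The argument runs on the graph of \<open>g\<close>. For
  \<open>g = (\<lambda>x. - f x)\<close> a reflection leads back to the graph of \<open>f\<close>,
  and approximate derivatives change sign.\<close>

lemma hausdorff1_null_cone_piece:
  fixes f :: "real \<Rightarrow> real"
  assumes I: "is_interval I" and f: "continuous_on I f" and n: "n \<ge> 1" and pq: "{p..q} \<subseteq> I" "q - p < 1 / (2 * real n)"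
    and g: "g \<in> {f, \<lambda>x. - f x}" and Q: "Q \<in> {cone_right, cone_left}"
  shows "hausdorff1 (graph_pt f ` {y. p < y \<and> y < q \<and> M_at f I n y \<and> Q g I n y \<and> \<not> (\<exists>L. has_ap_deriv f I y L)}) = 0"
proof -
  define B where "B = {y. p < y \<and> y < q \<and> M_at f I n y \<and> Q g I n y}"
  have contg: "continuous_on I g"
    using g f by (auto intro: continuous_on_minus)
  have Mg: "M_at g I n y" if "y \<in> B" for y
    using that g by (auto simp: B_def M_at_uminus)
  have BI: "y \<in> I" if "y \<in> B" for y
    using that pq(1) by (auto simp: B_def)
  have "1 / (2 * real n) \<le> 1 / real n"
    using n by (simp add: field_simps)
  then have "q - p < 1 / n"
    using pq(2) by linarith
  have "hausdorff1 (graph_pt g ` {x\<in>B. \<not> (\<exists>L. has_ap_deriv g I x L)}) = 0"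
  proof (rule hausdorff1_null_piece[OF contg pq(1) \<open>q - p < 1 / n\<close> n, of "2 * real n * (1 + real n)"])
    show "B \<subseteq> {p<..<q}"
      by (auto simp: B_def)
    show "M_at g I n y" if "y \<in> B" for y
      using that by (rule Mg)
    show "g y - g x \<le> 2 * real n * (1 + real n) * (y - x)" if xy: "x \<in> B" "y \<in> B" "x < y" for x y
      using xy pq(2) Q by (intro cone_growth[OF I contg n BI BI _ _ Mg Mg]) (auto simp: B_def)
  qed simp
  then have null: "hausdorff1 (graph_pt g ` {x\<in>B. \<not> (\<exists>L. has_ap_deriv f I x L)}) = 0"
  proof (rule hausdorff1_null_subset)
    have "has_ap_deriv f I x (- L)" if "has_ap_deriv (\<lambda>x. - f x) I x L" for x L
      using that by (rule has_ap_deriv_uminus)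
    then show "graph_pt g ` {x\<in>B. \<not> (\<exists>L. has_ap_deriv f I x L)} \<subseteq> graph_pt g ` {x\<in>B. \<not> (\<exists>L. has_ap_deriv g I x L)}"
      using g by (intro image_mono) blast
  qed
  have set_eq: "{y. p < y \<and> y < q \<and> M_at f I n y \<and> Q g I n y \<and> \<not> (\<exists>L. has_ap_deriv f I y L)} =
      {x\<in>B. \<not> (\<exists>L. has_ap_deriv f I x L)}"
    by (auto simp: B_def)
  consider "g = f" | "g = (\<lambda>x. - f x)"
    using g by blast
  then show ?thesis
    unfolding set_eq
  proof cases
    case 1
    then show "hausdorff1 (graph_pt f ` {x\<in>B. \<not> (\<exists>L. has_ap_deriv f I x L)}) = 0"
      using null by simp
  next
    case 2
    let ?h = "\<lambda>(x, y). (x, - y) :: real \<times> real"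
    have "hausdorff1 (?h ` (graph_pt g ` {x\<in>B. \<not> (\<exists>L. has_ap_deriv f I x L)})) = 0"
      using null by (rule hausdorff1_null_nonexpansive_image)
        (auto simp: dist_Pair_Pair dist_real_def abs_minus_commute)
    moreover have "?h (graph_pt g x) = graph_pt f x" for x
      using 2 by (simp add: graph_pt_def)
    ultimately show "hausdorff1 (graph_pt f ` {x\<in>B. \<not> (\<exists>L. has_ap_deriv f I x L)}) = 0"
      by (simp add: image_image)
  qed
qed

text \<open>Rational \<open>p\<close> and \<open>q\<close>, an index \<open>n\<close> and four
  choices of \<open>g\<close> and \<open>Q\<close> catch every relevant interior point, so countably
  many pieces suffice. The endpoints of \<open>I\<close> are added so that the complement consists
  of interior points, where one-sided windows eventually lie in \<open>I\<close>.\<close>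

lemma hausdorff1_exceptional_set:
  fixes f :: "real \<Rightarrow> real"
  assumes I: "is_interval I" and f: "continuous_on I f"
  shows "hausdorff1 (graph_pt f ` ((I - interior I) \<union> {y\<in>I. M_point f I y \<and> y \<notin> D_ap f I \<union> K_ap f I})) = 0"
proof -
  define \<T> where "\<T> = {(n::nat, p, q). n \<ge> 1 \<and> p \<in> \<rat> \<and> q \<in> \<rat> \<and> {p..q} \<subseteq> I \<and> q - p < 1 / (2 * real n)}
    \<times> ({f, \<lambda>x. - f x} \<times> {cone_right, cone_left})"
  define S where "S = (\<lambda>((n, p, q), g :: real \<Rightarrow> real, Q). {y. p < y \<and> y < q \<and> M_at f I n y \<and> Q g I n y \<and> \<not> (\<exists>L. has_ap_deriv f I y L)})"
  have "countable {(n::nat, p, q). n \<ge> 1 \<and> p \<in> \<rat> \<and> q \<in> \<rat> \<and> {p..q} \<subseteq> I \<and> q - p < 1 / (2 * real n)}"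
    by (rule countable_subset[OF _ countable_SIGMA[OF _ countable_SIGMA[OF countable_rat countable_rat], of UNIV]]) auto
  then have "countable \<T>"
    unfolding \<T>_def by (intro countable_SIGMA) auto
  moreover have "hausdorff1 (graph_pt f ` S t) = 0" if "t \<in> \<T>" for t
  proof -
    obtain n p q g Q where t: "t = ((n, p, q), g, Q)"
      by (metis prod.exhaust)
    have "n \<ge> 1" "{p..q} \<subseteq> I" "q - p < 1 / (2 * real n)" "g \<in> {f, \<lambda>x. - f x}" "Q \<in> {cone_right, cone_left}"
      using \<open>t \<in> \<T>\<close> unfolding t \<T>_def mem_Times_iff mem_Collect_eq prod.case fst_conv snd_conv by simp_all
    then show ?thesis
      unfolding t S_def prod.case by (rule hausdorff1_null_cone_piece[OF I f])
  qed
  ultimately have null1: "hausdorff1 (\<Union>t\<in>\<T>. graph_pt f ` S t) = 0"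
    using hausdorff1_null_UN[of \<T> "\<lambda>t. graph_pt f ` S t"] by simp
  have null2: "hausdorff1 (graph_pt f ` (I - interior I)) = 0"
    using hausdorff1_null_UN[OF countable_interval_minus_interior[OF I] hausdorff1_sing, of "graph_pt f"]
    by (simp add: UNION_singleton_eq_range)
  have "y \<in> (\<Union>t\<in>\<T>. S t)" if y: "y \<in> interior I" "M_point f I y" "y \<notin> D_ap f I \<union> K_ap f I" for y
  proof -
    have "y \<in> I" "y \<notin> K_ap f I"
      using y interior_subset by auto
    from not_K_ap_imp_cone[OF this] obtain g Q where g: "g \<in> {f, \<lambda>x. - f x}" "Q \<in> {cone_right, cone_left}"
      and ev: "\<forall>\<^sub>F n in sequentially. Q g I n y"
      by (elim bexE)
    have "\<forall>\<^sub>F n in sequentially. n \<ge> 1 \<and> M_at f I n y \<and> Q g I n y"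
      by (intro eventually_conj eventually_ge_at_top M_point_imp_M_at[OF y(2)] ev)
    then obtain n where n: "n \<ge> 1" "M_at f I n y" "Q g I n y"
      using eventually_happens'[OF trivial_limit_sequentially] by blast
    obtain e where e: "e > 0" "ball y e \<subseteq> I"
      using y(1) mem_interior by blast
    \<comment> \<open>The length \<open>q - p\<close> is below \<open>2 * s\<close>, so
      \<open>1 / (4 * real n)\<close> meets the bound \<open>1 / (2 * real n)\<close> on the
      pieces.\<close>
    define s where "s = min e (1 / (4 * real n))"
    have s: "s > 0" "s \<le> e" "s \<le> 1 / (4 * real n)"
      using e(1) n(1) by (auto simp: s_def)
    obtain p q where pq: "p \<in> \<rat>" "q \<in> \<rat>" "y - s < p" "p < y" "y < q" "q < y + s"
      using Rats_dense_in_real[of "y - s" y] Rats_dense_in_real[of y "y + s"] s(1) by auto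
    have "{p..q} \<subseteq> ball y e"
      using pq s(2) by (auto simp: dist_real_def)
    moreover have "q - p < 1 / (2 * real n)"
    proof -
      have "q - p < 2 * s"
        using pq by linarith
      also have "\<dots> \<le> 1 / (2 * real n)"
        using s(3) by simp
      finally show ?thesis .
    qed
    ultimately have "((n, p, q), g, Q) \<in> \<T>"
      using e(2) pq n(1) g unfolding \<T>_def by auto
    moreover have "y \<in> S ((n, p, q), g, Q)"
      using pq n y has_ap_deriv_D_ap[OF f y(1)] unfolding S_def by auto
    ultimately show ?thesis
      by blast
  qed
  then have sub: "{y\<in>I. M_point f I y \<and> y \<notin> D_ap f I \<union> K_ap f I} \<subseteq> (I - interior I) \<union> (\<Union>t\<in>\<T>. S t)"
    by blast
  have "graph_pt f ` ((I - interior I) \<union> {y\<in>I. M_point f I y \<and> y \<notin> D_ap f I \<union> K_ap f I})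
      \<subseteq> graph_pt f ` ((I - interior I) \<union> (\<Union>t\<in>\<T>. S t))"
    using sub by (intro image_mono) blast
  also have "\<dots> = graph_pt f ` (I - interior I) \<union> (\<Union>t\<in>\<T>. graph_pt f ` S t)"
    by (simp only: image_Un image_UN)
  finally show ?thesis
    by (rule hausdorff1_null_subset[OF hausdorff1_null_Un[OF null2 null1]])
qed

theorem theorem3p2:
  fixes I :: "real set" and f :: "real \<Rightarrow> real"
  assumes "is_interval I" and "\<exists>a\<in>I. \<exists>b\<in>I. a < b" and "continuous_on I f"
  shows "(\<forall>y\<in>I. has_fin_or_inf_deriv f I y \<longrightarrow> M_point f I y)
       \<and> (\<exists>E\<subseteq>I. hausdorff1 (graph_pt f ` E) = 0 \<and>
             (\<forall>y. M_point f I y \<longrightarrow> y \<in> D_ap f I \<union> K_ap f I \<union> E))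
       \<and> (\<exists>N\<subseteq>I. hausdorff1 (graph_pt f ` N) = 0 \<and>
             (\<forall>y\<in>I. M_point f I y \<and> y \<notin> D_ap f I \<and> y \<notin> N \<longrightarrow> knot_point f I y))"
proof -
  \<comment> \<open>This set also serves as \<open>N\<close>: an M-point outside it and outside
    \<open>D_ap\<close> is an interior point of \<open>K_ap\<close>, hence a knot point.\<close>
  define E where "E = (I - interior I) \<union> {y\<in>I. M_point f I y \<and> y \<notin> D_ap f I \<union> K_ap f I}"
  have E: "E \<subseteq> I" "hausdorff1 (graph_pt f ` E) = 0"
    unfolding E_def using hausdorff1_exceptional_set[OF assms(1,3)] by auto
  have "y \<in> I" if "M_point f I y" for y
    using that by (auto simp: M_point_def M_c_point_def)
  then have "\<forall>y. M_point f I y \<longrightarrow> y \<in> D_ap f I \<union> K_ap f I \<union> E"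
    by (auto simp: E_def)
  moreover have "\<forall>y\<in>I. M_point f I y \<and> y \<notin> D_ap f I \<and> y \<notin> E \<longrightarrow> knot_point f I y"
    using K_ap_imp_knot_point[OF assms(3)] by (auto simp: E_def)
  ultimately show ?thesis
    using E deriv_imp_M_point by blast
qed

end
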